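(* Let $f(z) = R(z) - \overline{z}$, where $R$ is a rational function with $\deg(R) \geq 2$, satisfy $\lim_{z \to \infty} f(z) = \infty$. Further, let $z_0 \in \mathbb{C}$ and the integer $n \geq 3$ satisfy $$f(z_0)=0,\quad R'(z_0) = \ldots = R^{(n-2)}(z_0) = 0,\quad\text{and}\quad R^{(n-1)}(z_0)\neq 0,$$ and set $\eta := \left(\frac{n}{n-1}\right)^{1/2}$. Then, for all sufficiently small $\varepsilon > 0$, the disk $\overline{D}(z_0, \eta\sqrt{\varepsilon})$ contains no further zero of $f$ (i.e. no zero other than $z_0$), and the function $$F(z) := f(z) + \frac{\varepsilon}{z-z_0}$$ satisfies the following: (i) $F$ has at least $n$ zeros in $A(z_0, \eta^{-1}\sqrt{\varepsilon}, \sqrt{\varepsilon})$, at least $n$ zeros in $A(z_0, \sqrt{\varepsilon}, \eta\sqrt{\varepsilon})$, and no zeros in $\overline{D}(z_0, \eta^{-1}\sqrt{\varepsilon})$. If $F$ is regular, then at least $n$ of its zeros in $A(z_0, \eta^{-1}\sqrt{\varepsilon}, \sqrt{\varepsilon})$ are sense-preserving and at least $n$ of its zeros in $A(z_0, \sqrt{\varepsilon}, \eta\sqrt{\varepsilon})$ are sense-reversing. (ii) Denote the regular zeros of $f$ outside $\overline{D}(z_0, \eta\sqrt{\varepsilon})$ by $z_1, \ldots, z_N$. Then there exist mutually disjoint disks $\overline{D}(z_k, r)$, $1 \le k \le N$, such that $F$ has exactly one zero in each $D(z_k, r)$, and the (Poincaré) index of this zero is $\mathrm{ind}(z_k; f)$.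 (iii) If $f$ is regular, then $f$ and $F$ have the same number of zeros outside $\overline{D}(z_0, \eta\sqrt{\varepsilon})$.
   Context: The degree of a rational function $R = p/q$ with coprime polynomials $p, q$ is $\deg(R) = \max\{\deg p, \deg q\}$. $D(z,r)$ and $\overline{D}(z,r)$ denote the open and closed disks of radius $r>0$ around $z \in \mathbb{C}$; $A(z,r,s)$ denotes the open annulus $\{\zeta : r < |\zeta - z| < s\}$. For a rational function $R$, let $f(z) = R(z) - \overline{z}$. At $z_0\in\mathbb{C}$, $f$ is called sense-preserving if $|R'(z_0)| > 1$ and sense-reversing if $|R'(z_0)| < 1$; if $|R'(z_0)| = 1$, $z_0$ is a singular point. If additionally $f(z_0) = 0$, then $z_0$ is called a sense-preserving, sense-reversing or singular zero of $f$, respectively. A zero that is not singular is called regular. The function $f$ is called regular if all its zeros are regular. The same terminology is applied to $F$, with $R$ replaced by its analytic part $R(z) + \frac{\varepsilon}{z-z_0}$. Zeros are counted as distinct points. Poincaré index: if $g$ is continuous and nonzero in a punctured neighborhood of $\zeta$, and $g$ is either zero, not continuous, or not defined at $\zeta$, then $\mathrm{ind}(\zeta; g) := \frac{1}{2\pi}\Delta_\gamma \arg g(z) \in \mathbb{Z}$, the change of a continuous branch of $\arg g$ (divided by $2\pi$) along a positively oriented closed Jordan curve $\gamma$ in the punctured neighborhood surrounding $\zeta$; it is independent of the choice of $\gamma$. *)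

theory Defs
  imports "HOL-Complex_Analysis.Complex_Analysis"
begin

text \<open>
  The functions studied are \<open>z \<mapsto> A z - cnj z\<close> with \<open>A\<close> rational. The definitions below take the
  analytic part \<open>A\<close> as their argument.
\<close>

definition minus_conj :: "(complex \<Rightarrow> complex) \<Rightarrow> complex \<Rightarrow> complex" where
  "minus_conj A z = A z - cnj z"

text \<open>
  Division by zero yields zero in HOL, so a quotient has a spurious value at its poles, where the
  rational function is undefined. Hence a zero is required not to be a pole.
\<close>

definition zeros :: "(complex \<Rightarrow> complex) \<Rightarrow> complex set" where
  "zeros A = {z. \<not> is_pole A z \<and> minus_conj A z = 0}"

definition sense_preserving :: "(complex \<Rightarrow> complex) \<Rightarrow> complex \<Rightarrow> bool" where
  "sense_preserving A z \<longleftrightarrow> norm (deriv A z) > 1"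

definition sense_reversing :: "(complex \<Rightarrow> complex) \<Rightarrow> complex \<Rightarrow> bool" where
  "sense_reversing A z \<longleftrightarrow> norm (deriv A z) < 1"

definition singular_point :: "(complex \<Rightarrow> complex) \<Rightarrow> complex \<Rightarrow> bool" where
  "singular_point A z \<longleftrightarrow> norm (deriv A z) = 1"

definition regular_zeros :: "(complex \<Rightarrow> complex) \<Rightarrow> complex set" where
  "regular_zeros A = {z \<in> zeros A. \<not> singular_point A z}"

definition regular :: "(complex \<Rightarrow> complex) \<Rightarrow> bool" where
  "regular A \<longleftrightarrow> zeros A = regular_zeros A"

definition annulus :: "complex \<Rightarrow> real \<Rightarrow> real \<Rightarrow> complex set" where
  "annulus z r s = {\<zeta>. r < norm (\<zeta> - z) \<and> norm (\<zeta> - z) < s}"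

text \<open>
  The change of argument of \<open>g\<close> along \<open>\<gamma>\<close>, divided by \<open>2\<pi>\<close>, is the winding number of \<open>g \<circ> \<gamma>\<close>
  about \<open>0\<close>; see \<open>winding_number_eq_arg_change\<close> below. A closed Jordan curve is positively
  oriented and surrounds \<open>\<zeta>\<close> iff its winding number about \<open>\<zeta>\<close> is \<open>1\<close>. The integer \<open>k\<close> does not depend
  on the curve, nor on the punctured neighbourhood.
\<close>

definition has_poincare_index :: "complex \<Rightarrow> (complex \<Rightarrow> complex) \<Rightarrow> int \<Rightarrow> bool" where
  "has_poincare_index \<zeta> g k \<longleftrightarrow>
     (\<exists>r>0. continuous_on (ball \<zeta> r - {\<zeta>}) g \<and> (\<forall>z\<in>ball \<zeta> r - {\<zeta>}. g z \<noteq> 0) \<and>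
       (\<forall>\<gamma>. simple_path \<gamma> \<and> pathfinish \<gamma> = pathstart \<gamma> \<and>
            path_image \<gamma> \<subseteq> ball \<zeta> r - {\<zeta>} \<and> winding_number \<gamma> \<zeta> = 1
          \<longrightarrow> winding_number (g \<circ> \<gamma>) 0 = of_int k))"

definition poincare_index :: "complex \<Rightarrow> (complex \<Rightarrow> complex) \<Rightarrow> int" where
  "poincare_index \<zeta> g = (THE k. has_poincare_index \<zeta> g k)"

lemma winding_number_eq_arg_change:
  fixes h :: "real \<Rightarrow> complex" and \<theta> :: "real \<Rightarrow> real"
  assumes "path h" "pathfinish h = pathstart h" "0 \<notin> path_image h"
    and "continuous_on {0..1} \<theta>" "\<And>t. t \<in> {0..1} \<Longrightarrow> h t = of_real (norm (h t)) * cis (\<theta> t)"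
  shows "winding_number h 0 = of_real ((\<theta> 1 - \<theta> 0) / (2 * pi))"
proof -
  define l where "l = (\<lambda>t. of_real (ln (norm (h t))) + \<i> * of_real (\<theta> t))"
  have nz: "h t \<noteq> 0" if "t \<in> {0..1}" for t
    using assms(3) that by (auto simp: path_image_def)
  have l: "path l"
    unfolding l_def path_def using assms(1,4) nz
    by (intro continuous_intros) (auto simp: path_def)
  have hl: "h t = exp (l t)" if "t \<in> {0..1}" for t
    using assms(5)[OF that] nz[OF that]
    by (simp add: l_def exp_add cis_conv_exp exp_of_real)
  obtain q where q: "path q" "pathfinish q - pathstart q = 2 * of_real pi * \<i> * winding_number h 0"
    and hq: "\<And>t. t \<in> {0..1} \<Longrightarrow> h t = 0 + exp (q t)"
    using winding_number_as_continuous_log[OF assms(1,3)] by metis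
  have "(\<lambda>t. l t - q t) constant_on {0..1}"
  proof (rule continuous_discrete_range_constant)
    show "continuous_on {0..1} (\<lambda>t. l t - q t)"
      using l q(1) by (intro continuous_intros) (auto simp: path_def)
    show "\<exists>e>0. \<forall>y. y \<in> {0..1} \<and> l y - q y \<noteq> l x - q x \<longrightarrow> e \<le> norm ((l y - q y) - (l x - q x))"
      if x: "x \<in> {0..1}" for x
    proof (intro exI[of _ "2 * pi"] conjI allI impI)
      fix y assume y: "y \<in> {0..1} \<and> l y - q y \<noteq> l x - q x"
      have "exp (l s - q s) = 1" if "s \<in> {0..1}" for s
        using hl[OF that] hq[OF that] by (simp add: exp_diff)
      with x y have "exp (l y - q y) = exp (l x - q x)"
        by simp
      then obtain m :: int where m: "l y - q y = l x - q x + of_int (2 * m) * of_real pi * \<i>"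
        unfolding exp_eq by (auto simp: mult_ac)
      with y have "m \<noteq> 0" by auto
      then have "1 \<le> \<bar>real_of_int m\<bar>" by linarith
      moreover have "norm ((l y - q y) - (l x - q x)) = 2 * \<bar>real_of_int m\<bar> * pi"
        using m by (simp add: norm_mult)
      ultimately show "2 * pi \<le> norm ((l y - q y) - (l x - q x))" by simp
    qed simp
  qed simp
  then have "l 1 - q 1 = l 0 - q 0" unfolding constant_on_def by force
  then have "2 * of_real pi * \<i> * winding_number h 0 = l 1 - l 0"
    using q(2) by (simp add: pathfinish_def pathstart_def algebra_simps)
  also have "\<dots> = \<i> * of_real (\<theta> 1 - \<theta> 0)"
    using assms(2) by (simp add: l_def pathfinish_def pathstart_def algebra_simps)
  finally have "\<i> * (2 * of_real pi * winding_number h 0) = \<i> * of_real (\<theta> 1 - \<theta> 0)"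
    by (simp add: mult_ac)
  then have "2 * of_real pi * winding_number h 0 = of_real (\<theta> 1 - \<theta> 0)"
    by (simp only: mult_left_cancel complex_i_not_zero not_False_eq_True)
  then show ?thesis by (simp add: field_simps)
qed

lemma poincare_index_unique:
  assumes "has_poincare_index \<zeta> g k"
  shows "poincare_index \<zeta> g = k"
  unfolding poincare_index_def
proof (rule the_equality)
  show "has_poincare_index \<zeta> g k" by (rule assms)
next
  fix m assume "has_poincare_index \<zeta> g m"
  then obtain r where r: "r > 0"
    and rw: "\<And>\<gamma>. simple_path \<gamma> \<Longrightarrow> pathfinish \<gamma> = pathstart \<gamma> \<Longrightarrow>
      path_image \<gamma> \<subseteq> ball \<zeta> r - {\<zeta>} \<Longrightarrow> winding_number \<gamma> \<zeta> = 1 \<Longrightarrow> winding_number (g \<circ> \<gamma>) 0 = of_int m"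
    unfolding has_poincare_index_def by blast
  obtain s where s: "s > 0"
    and sw: "\<And>\<gamma>. simple_path \<gamma> \<Longrightarrow> pathfinish \<gamma> = pathstart \<gamma> \<Longrightarrow>
      path_image \<gamma> \<subseteq> ball \<zeta> s - {\<zeta>} \<Longrightarrow> winding_number \<gamma> \<zeta> = 1 \<Longrightarrow> winding_number (g \<circ> \<gamma>) 0 = of_int k"
    using assms unfolding has_poincare_index_def by blast
  define c where "c = circlepath \<zeta> (min r s / 2)"
  have c: "simple_path c" "pathfinish c = pathstart c" "winding_number c \<zeta> = 1"
    using r s by (auto simp: c_def simple_path_circlepath winding_number_circlepath_centre)
  have "path_image c \<subseteq> ball \<zeta> r - {\<zeta>}" "path_image c \<subseteq> ball \<zeta> s - {\<zeta>}"
    using r s by (auto simp: c_def path_image_circlepath)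
  then have "(of_int m :: complex) = of_int k"
    using rw[OF c(1,2) _ c(3)] sw[OF c(1,2) _ c(3)] by simp
  then show "m = k" by simp
qed

end

theory Submission
  imports Defs
begin

text \<open>
  Write \<open>\<zeta> = z - z\<^sub>0\<close> and \<open>H = \<zeta> (R z - R z\<^sub>0)\<close>, which vanishes to order \<open>n\<close> at \<open>z\<^sub>0\<close>. Multiplying by \<open>\<zeta>\<close> turns
  \<open>F z = 0\<close> into \<open>H = \<bar>\<zeta>\<bar>\<^sup>2 - \<epsilon>\<close>. In particular \<open>H\<close> is real at the zeros of \<open>F\<close>; since \<open>\<bar>H\<bar> < \<bar>\<zeta>\<bar>\<^sup>2 / n\<close> near \<open>z\<^sub>0\<close>,
  these zeros lie between the radii \<open>\<eta>\<^sup>-\<^sup>1 \<surd>\<epsilon>\<close> and \<open>\<eta> \<surd>\<epsilon>\<close>, inside or outside \<open>\<surd>\<epsilon>\<close> according to the sign of \<open>H\<close>,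
  and this sign also decides the orientation. Locally \<open>H = \<psi> ^ n\<close> with \<open>\<psi>\<close> injective, so \<open>H\<close> is real on \<open>2 n\<close> curves,
  \<open>n\<close> for each sign, and every one of them carries a zero. Away from \<open>z\<^sub>0\<close>, the term \<open>\<epsilon> / \<zeta>\<close> is a \<open>C\<^sup>1\<close>-small
  perturbation: a contraction argument continues each regular zero with its index, and compactness excludes other zeros.
\<close>

section \<open>Regular zeros\<close>

text \<open>Multiplication by \<open>c\<close> adds the constant \<open>Im (Ln c)\<close> to a
  continuous argument of \<open>\<gamma> - a\<close>, and this constant cancels between the
  endpoints.\<close>

lemma winding_number_cmult_loop:
  assumes "path \<gamma>" "pathfinish \<gamma> = pathstart \<gamma>" "a \<notin> path_image \<gamma>" "c \<noteq> 0"
  shows "winding_number (\<lambda>t. c * (\<gamma> t - a)) 0 = winding_number \<gamma> a"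
proof -
  obtain q where q: "path q" "\<And>t. t \<in> {0..1} \<Longrightarrow> \<gamma> t = a + exp (q t)"
    using winding_number_as_continuous_log[OF assms(1,3)] by metis
  have polar: "winding_number (\<lambda>t. b * (\<gamma> t - a)) 0 = of_real ((Im (q 1) - Im (q 0)) / (2 * pi))"
    if "b \<noteq> 0" for b
  proof -
    have "winding_number (\<lambda>t. b * (\<gamma> t - a)) 0
        = of_real (((Im (q 1) + Im (Ln b)) - (Im (q 0) + Im (Ln b))) / (2 * pi))"
    proof (rule winding_number_eq_arg_change)
      show "path (\<lambda>t. b * (\<gamma> t - a))"
        using assms(1) unfolding path_def by (intro continuous_intros)
      show "pathfinish (\<lambda>t. b * (\<gamma> t - a)) = pathstart (\<lambda>t. b * (\<gamma> t - a))"
        using assms(2) by (simp add: pathfinish_def pathstart_def)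
      show "0 \<notin> path_image (\<lambda>t. b * (\<gamma> t - a))"
        using assms(3) that by (auto simp: path_image_def)
      show "continuous_on {0..1} (\<lambda>t. Im (q t) + Im (Ln b))"
        using q(1) unfolding path_def by (intro continuous_intros)
      fix t :: real assume t: "t \<in> {0..1}"
      have "b * (\<gamma> t - a) = exp (q t + Ln b)"
        using q(2)[OF t] that by (simp add: exp_add)
      then show "b * (\<gamma> t - a)
          = of_real (norm (b * (\<gamma> t - a))) * cis (Im (q t) + Im (Ln b))"
        using exp_eq_polar[of "q t + Ln b"] norm_exp_eq_Re[of "q t + Ln b"]
        by (metis plus_complex.sel(2))
    qed
    then show ?thesis by simp
  qed
  have "winding_number \<gamma> a = winding_number (\<lambda>t. 1 * (\<gamma> t - a)) 0"
    by (subst winding_number_offset) simp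
  with polar[of 1] polar[OF assms(4)] show ?thesis by simp
qed

text \<open>Rouche's argument: along any loop \<open>g\<close> stays closer to
  \<open>c * (z - a)\<close> than this linear map is to \<open>0\<close>, so both images wind
  equally often about \<open>0\<close>.\<close>

lemma has_poincare_index_near_linear:
  assumes "r > 0" and cont: "continuous_on (ball a r - {a}) g"
    and near: "\<And>z. z \<in> ball a r - {a} \<Longrightarrow> norm (g z - c * (z - a)) < norm (c * (z - a))"
  shows "has_poincare_index a g 1"
  unfolding has_poincare_index_def
proof (intro exI[of _ r] conjI ballI allI impI)
  fix z assume "z \<in> ball a r - {a}"
  with near[OF this] show "g z \<noteq> 0" by auto
next
  fix \<gamma> assume \<gamma>: "simple_path \<gamma> \<and> pathfinish \<gamma> = pathstart \<gamma> \<and>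
      path_image \<gamma> \<subseteq> ball a r - {a} \<and> winding_number \<gamma> a = 1"
  then have p: "path \<gamma>" "pathfinish \<gamma> = pathstart \<gamma>" "a \<notin> path_image \<gamma>"
    by (auto intro: simple_path_imp_path)
  have "\<gamma> t \<in> ball a r - {a}" if "t \<in> {0..1}" for t
    using \<gamma> that by (metis imageI path_image_def subsetD)
  then have near': "norm (g (\<gamma> t) - c * (\<gamma> t - a)) < norm (c * (\<gamma> t - a))" if "t \<in> {0..1}" for t
    using near that by blast
  \<comment> \<open>Strictness of the inequality at a single point already excludes
    \<open>c = 0\<close>.\<close>
  have "c \<noteq> 0" using near'[of 0] by auto
  have "winding_number (g \<circ> \<gamma>) 0 = winding_number (\<lambda>t. c * (\<gamma> t - a)) 0"
  proof (rule winding_number_nearby_loops_eq)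
    show "path (\<lambda>t. c * (\<gamma> t - a))"
      using p(1) unfolding path_def by (intro continuous_intros)
    show "path (g \<circ> \<gamma>)"
      using p(1) \<gamma> cont by (intro path_continuous_image) (auto intro: continuous_on_subset)
    show "pathfinish (\<lambda>t. c * (\<gamma> t - a)) = pathstart (\<lambda>t. c * (\<gamma> t - a))"
      using p(2) by (simp add: pathfinish_def pathstart_def)
    show "pathfinish (g \<circ> \<gamma>) = pathstart (g \<circ> \<gamma>)"
      using p(2) by (simp add: pathfinish_compose pathstart_compose)
  qed (use near' in simp)
  also have "\<dots> = 1" using winding_number_cmult_loop[OF p \<open>c \<noteq> 0\<close>] \<gamma> by simp
  finally show "winding_number (g \<circ> \<gamma>) 0 = of_int 1" by simp
qed (use assms in auto)

text \<open>Reflection reverses the winding. This reduces the sense-reversing case, where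
  \<open>- cnj z\<close> dominates, to a nearly linear map.\<close>

lemma has_poincare_index_cnj:
  assumes "has_poincare_index a g k"
  shows "has_poincare_index a (\<lambda>z. cnj (g z)) (- k)"
proof -
  obtain r where r: "r > 0" "continuous_on (ball a r - {a}) g" "\<forall>z\<in>ball a r - {a}. g z \<noteq> 0"
    and w: "\<And>\<gamma>. simple_path \<gamma> \<Longrightarrow> pathfinish \<gamma> = pathstart \<gamma> \<Longrightarrow>
      path_image \<gamma> \<subseteq> ball a r - {a} \<Longrightarrow> winding_number \<gamma> a = 1 \<Longrightarrow> winding_number (g \<circ> \<gamma>) 0 = of_int k"
    using assms unfolding has_poincare_index_def by blast
  show ?thesis
    unfolding has_poincare_index_def
  proof (intro exI[of _ r] conjI ballI allI impI)
    show "continuous_on (ball a r - {a}) (\<lambda>z. cnj (g z))"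
      using r(2) by (rule continuous_on_cnj)
    fix \<gamma> assume \<gamma>: "simple_path \<gamma> \<and> pathfinish \<gamma> = pathstart \<gamma> \<and>
        path_image \<gamma> \<subseteq> ball a r - {a} \<and> winding_number \<gamma> a = 1"
    have "path (g \<circ> \<gamma>)"
      using \<gamma> r(2) by (intro path_continuous_image) (auto intro: continuous_on_subset simple_path_imp_path)
    moreover have "0 \<notin> path_image (g \<circ> \<gamma>)"
      using \<gamma> r(3) by (fastforce simp: path_image_compose)
    ultimately have "winding_number (cnj \<circ> (g \<circ> \<gamma>)) (cnj 0) = - cnj (winding_number (g \<circ> \<gamma>) 0)"
      by (rule winding_number_cnj)
    with w[of \<gamma>] \<gamma> show "winding_number ((\<lambda>z. cnj (g z)) \<circ> \<gamma>) 0 = of_int (- k)"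
      by (simp add: o_def)
  qed (use r in auto)
qed

text \<open>To first order the function is \<open>c * h - cnj h\<close> with
  \<open>h = z - a\<close>, so the dominant one of the two terms decides the index. The strict bound
  \<open>near\<close> rules out \<open>norm c = 1\<close>, so the value \<open>- 1\<close> belongs
  to \<open>norm c < 1\<close>.\<close>

lemma has_poincare_index_harmonic:
  assumes "r > 0" and cont: "continuous_on (ball a r - {a}) A" and "A a = cnj a"
    and near: "\<And>z. z \<in> ball a r - {a} \<Longrightarrow>
      norm (A z - A a - c * (z - a)) < \<bar>norm c - 1\<bar> * norm (z - a)"
  shows "has_poincare_index a (\<lambda>z. A z - cnj z) (if norm c > 1 then 1 else - 1)"
proof (cases "norm c > 1")
  case True
  have "has_poincare_index a (\<lambda>z. A z - cnj z) 1"
  proof (rule has_poincare_index_near_linear[OF \<open>r > 0\<close>])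
    show "continuous_on (ball a r - {a}) (\<lambda>z. A z - cnj z)"
      using cont by (intro continuous_intros)
    fix z assume z: "z \<in> ball a r - {a}"
    have "A z - cnj z - c * (z - a) = (A z - A a - c * (z - a)) - cnj (z - a)"
      using \<open>A a = cnj a\<close> by simp
    then have "norm (A z - cnj z - c * (z - a)) \<le> norm (A z - A a - c * (z - a)) + norm (z - a)"
      by (metis complex_mod_cnj norm_triangle_ineq4)
    also have "\<dots> < \<bar>norm c - 1\<bar> * norm (z - a) + norm (z - a)" using near[OF z] by simp
    also have "\<dots> = norm (c * (z - a))" unfolding norm_mult using True by (simp add: algebra_simps)
    finally show "norm (A z - cnj z - c * (z - a)) < norm (c * (z - a))" .
  qed
  with True show ?thesis by simp
next
  case False
  \<comment> \<open>After conjugation the dominant term is \<open>- (z - a)\<close>.\<close>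
  have "has_poincare_index a (\<lambda>z. cnj (A z - cnj z)) 1"
  proof (rule has_poincare_index_near_linear[OF \<open>r > 0\<close>, where c = "- 1"])
    show "continuous_on (ball a r - {a}) (\<lambda>z. cnj (A z - cnj z))"
      using cont by (intro continuous_intros)
    fix z assume z: "z \<in> ball a r - {a}"
    have "norm (cnj (A z - cnj z) - (- 1) * (z - a)) = norm (cnj (A z - A a))"
      using \<open>A a = cnj a\<close> by simp
    also have "\<dots> = norm (A z - A a)" by (rule complex_mod_cnj)
    also have "\<dots> \<le> norm (A z - A a - c * (z - a)) + norm (c * (z - a))"
      by (metis diff_add_cancel norm_triangle_ineq)
    also have "\<dots> < \<bar>norm c - 1\<bar> * norm (z - a) + norm c * norm (z - a)"
      using near[OF z] by (simp add: norm_mult)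
    also have "\<dots> = norm ((- 1) * (z - a))"
      using False by (simp only: norm_mult norm_minus_cancel norm_one) (simp add: algebra_simps)
    finally show "norm (cnj (A z - cnj z) - (- 1) * (z - a)) < norm ((- 1) * (z - a))" .
  qed
  from has_poincare_index_cnj[OF this] False show ?thesis by simp
qed

section \<open>Continuation of regular zeros\<close>

text \<open>Reverse triangle inequality, read as quantitative injectivity of the real-linear
  derivative \<open>h \<mapsto> c * h - cnj h\<close> of \<open>A z - cnj z\<close>.\<close>

lemma norm_mult_diff_cnj_ge: "\<bar>norm c - 1\<bar> * norm h \<le> norm (c * h - cnj h)"
proof -
  have "\<bar>norm (c * h) - norm (cnj h)\<bar> \<le> norm (c * h - cnj h)"
    by (rule norm_triangle_ineq3)
  moreover have "norm (c * h) - norm (cnj h) = (norm c - 1) * norm h"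
    by (simp add: norm_mult algebra_simps)
  ultimately show ?thesis by (simp add: abs_mult)
qed

lemma mult_diff_cnj_surj:
  assumes "norm c \<noteq> 1"
  obtains h where "c * h - cnj h = w"
proof -
  have "c * cnj c = of_real ((norm c)\<^sup>2)" by (simp only: complex_norm_square)
  moreover have "(norm c)\<^sup>2 \<noteq> 1" using assms by (simp add: power2_eq_1_iff) (smt (verit) norm_ge_zero)
  ultimately have nz: "c * cnj c \<noteq> 1" by (metis of_real_eq_1_iff)
  define D where "D = c * cnj c - 1"
  have D: "D \<noteq> 0" "cnj D = D" using nz by (simp_all add: D_def mult.commute)
  \<comment> \<open>Adding \<open>cnj c\<close> times the equation to its conjugate eliminates
    \<open>cnj h\<close> and leaves \<open>D * h = cnj c * w + cnj w\<close>.\<close>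
  have "c * ((cnj c * w + cnj w) / D) - cnj ((cnj c * w + cnj w) / D)
      = (c * (cnj c * w + cnj w) - (c * cnj w + w)) / D"
    by (simp add: D(2) diff_divide_distrib)
  also have "c * (cnj c * w + cnj w) - (c * cnj w + w) = w * D"
    by (simp add: D_def algebra_simps)
  finally show ?thesis
    using D(1) that[of "(cnj c * w + cnj w) / D"] by simp
qed


text \<open>A quantitative inverse function theorem: the constant \<open>1 / 2\<close> in
  \<open>near\<close> becomes the contraction factor, and \<open>small\<close> moves the centre by
  less than \<open>r / 2\<close>, so the closed ball is mapped into the open one.\<close>

lemma perturbed_regular_zero_ex1:
  fixes A :: "complex \<Rightarrow> complex"
  defines "g \<equiv> \<lambda>z. A z - cnj z"
  assumes "norm c \<noteq> 1" "r > 0"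
    and near: "\<And>z w. z \<in> cball a r \<Longrightarrow> w \<in> cball a r \<Longrightarrow>
      norm (A z - A w - c * (z - w)) \<le> \<bar>norm c - 1\<bar> / 2 * norm (z - w)"
    and small: "norm (g a) < \<bar>norm c - 1\<bar> * r / 2"
  shows "\<exists>!w. w \<in> ball a r \<and> g w = 0"
proof -
  define m where "m = \<bar>norm c - 1\<bar>"
  have "m > 0" using assms by (simp add: m_def)
  obtain J where J: "\<And>w. c * J w - cnj (J w) = w"
  proof -
    have "\<exists>h. c * h - cnj h = w" for w
      by (rule mult_diff_cnj_surj[OF \<open>norm c \<noteq> 1\<close>]) blast
    then show ?thesis using that by metis
  qed
  have J_bound: "m * norm (h - J w) \<le> norm (c * h - cnj h - w)" for h w
    using norm_mult_diff_cnj_ge[of c "h - J w"] J[of w] by (simp add: m_def algebra_simps)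
  \<comment> \<open>Newton's map with the fixed real-linear derivative \<open>h \<mapsto> c h - cnj h\<close> is a contraction.\<close>
  define T where "T z = z - J (g z)" for z
  have T: "norm (T z - T w) \<le> 1 / 2 * norm (z - w)" if "z \<in> cball a r" "w \<in> cball a r" for z w
  proof -
    have "c * (J (g z) - J (g w)) - cnj (J (g z) - J (g w)) = g z - g w"
      using J[of "g z"] J[of "g w"] by (simp add: algebra_simps)
    moreover have "c * (T z - T w) - cnj (T z - T w)
        = c * (z - w) - cnj (z - w) - (c * (J (g z) - J (g w)) - cnj (J (g z) - J (g w)))"
      by (simp add: T_def algebra_simps)
    \<comment> \<open>The linear parts cancel, leaving only the deviation of \<open>A\<close> from
      its linearization.\<close>
    ultimately have "c * (T z - T w) - cnj (T z - T w) = - (A z - A w - c * (z - w))"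
      by (simp add: g_def)
    then have "m * norm (T z - T w) \<le> m / 2 * norm (z - w)"
      using norm_mult_diff_cnj_ge[of c "T z - T w"] near[OF that]
      unfolding m_def by (simp only: norm_minus_cancel)
    with \<open>m > 0\<close> show ?thesis by (simp add: field_simps)
  qed
  have Ta: "norm (T a - a) < r / 2"
  proof -
    have "m * norm (J (g a)) \<le> norm (g a)"
      using J_bound[of 0 "g a"] by simp
    then have "m * norm (J (g a)) < m * (r / 2)" using small by (simp add: m_def)
    with \<open>m > 0\<close> show ?thesis by (simp add: T_def)
  qed
  have T_ball: "T z \<in> ball a r" if "z \<in> cball a r" for z
  proof -
    have "norm (T z - a) \<le> norm (T z - T a) + norm (T a - a)"
      using norm_triangle_ineq[of "T z - T a" "T a - a"] by simp
    also have "\<dots> < 1 / 2 * norm (z - a) + r / 2"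
      using T[OF that, of a] Ta \<open>r > 0\<close> by simp
    also have "\<dots> \<le> r" using that by (simp add: dist_norm norm_minus_commute)
    finally show ?thesis by (simp add: dist_norm norm_minus_commute)
  qed
  have "\<exists>!w. w \<in> cball a r \<and> T w = w"
  proof (rule Banach_fix[of _ "1 / 2"])
    show "complete (cball a r)" by (simp add: complete_eq_closed)
    show "cball a r \<noteq> {}" using \<open>r > 0\<close> by simp
    show "T ` cball a r \<subseteq> cball a r" using T_ball ball_subset_cball by blast
    show "dist (T z) (T w) \<le> 1 / 2 * dist z w" if "z \<in> cball a r" "w \<in> cball a r" for z w
      using T[OF that] by (simp add: dist_norm)
  qed simp_all
  moreover have "T w = w \<longleftrightarrow> g w = 0" for w
  proof
    assume "T w = w"
    then have "J (g w) = 0" by (simp add: T_def)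
    with J[of "g w"] show "g w = 0" by simp
  next
    assume "g w = 0"
    \<comment> \<open>\<open>J\<close> is only a pointwise choice of preimages, so
      \<open>J 0 = 0\<close> is read off from the bound.\<close>
    moreover have "m * norm (J 0) \<le> 0" using J_bound[of 0 0] by simp
    ultimately show "T w = w" using \<open>m > 0\<close> by (simp add: T_def mult_le_0_iff)
  qed
  ultimately show ?thesis using T_ball
    by (metis ball_subset_cball subsetD)
qed

text \<open>Mean value inequality for \<open>A z - deriv A a * z\<close> on a ball where
  \<open>deriv A\<close> varies by less than \<open>e\<close>. Both points are free, as the
  contraction argument requires.\<close>

lemma strict_derivative_bound:
  fixes A :: "complex \<Rightarrow> complex"
  assumes "A holomorphic_on U" "open U" "a \<in> U" "e > 0"
  obtains r where "r > 0" "cball a r \<subseteq> U"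
    "\<And>z w. z \<in> cball a r \<Longrightarrow> w \<in> cball a r \<Longrightarrow> norm (A z - A w - deriv A a * (z - w)) \<le> e * norm (z - w)"
proof -
  have "continuous_on U (deriv A)"
    using assms by (simp add: holomorphic_deriv holomorphic_on_imp_continuous_on)
  then have "isCont (deriv A) a" using assms continuous_on_eq_continuous_at by blast
  then obtain d where d: "d > 0" "\<And>z. dist z a < d \<Longrightarrow> dist (deriv A z) (deriv A a) < e"
    using \<open>e > 0\<close> unfolding continuous_at_eps_delta by blast
  obtain s where s: "s > 0" "ball a s \<subseteq> U" using assms openE by blast
  define r where "r = min d s / 2"
  have r: "r > 0" "cball a r \<subseteq> U" "\<And>z. z \<in> cball a r \<Longrightarrow> dist z a < d"
    using d(1) s by (auto simp: r_def dist_commute subset_iff)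
  show ?thesis
  proof (rule that[of r])
    fix z w assume zw: "z \<in> cball a r" "w \<in> cball a r"
    have "norm ((A z - deriv A a * z) - (A w - deriv A a * w)) \<le> e * norm (z - w)"
    proof (rule field_differentiable_bound[where S = "cball a r" and f' = "\<lambda>z. deriv A z - deriv A a"])
      fix x assume x: "x \<in> cball a r"
      have "(A has_field_derivative deriv A x) (at x)"
        using x r(2) assms holomorphic_derivI by blast
      then show "((\<lambda>z. A z - deriv A a * z) has_field_derivative deriv A x - deriv A a)
          (at x within cball a r)"
        by (auto intro!: derivative_eq_intros intro: DERIV_subset)
      show "norm (deriv A x - deriv A a) \<le> e"
        using d(2)[OF r(3)[OF x]] by (simp add: dist_norm)
    qed (use zw in auto)
    then show "norm (A z - A w - deriv A a * (z - w)) \<le> e * norm (z - w)"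
      by (simp add: algebra_simps)
  qed (use r in auto)
qed

text \<open>The uniqueness half of \<open>perturbed_regular_zero_ex1\<close>, applied with the zero
  itself as centre.\<close>

lemma regular_zero_isolated:
  assumes "A holomorphic_on U" "open U" "a \<in> U" "A a = cnj a" "norm (deriv A a) \<noteq> 1"
  obtains r where "r > 0" "\<And>z. z \<in> ball a r \<Longrightarrow> A z = cnj z \<Longrightarrow> z = a"
proof -
  define m where "m = \<bar>norm (deriv A a) - 1\<bar>"
  have "m / 2 > 0" using assms by (simp add: m_def)
  from strict_derivative_bound[OF assms(1-3) this]
  obtain r where r: "r > 0" "cball a r \<subseteq> U"
    "\<And>z w. z \<in> cball a r \<Longrightarrow> w \<in> cball a r \<Longrightarrow> norm (A z - A w - deriv A a * (z - w)) \<le> m / 2 * norm (z - w)"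
    by blast
  have "\<exists>!w. w \<in> ball a r \<and> A w - cnj w = 0"
  proof (rule perturbed_regular_zero_ex1[where c = "deriv A a", OF assms(5) r(1)])
    show "norm (A a - cnj a) < \<bar>norm (deriv A a) - 1\<bar> * r / 2"
      using r(1) \<open>m / 2 > 0\<close> by (simp add: assms(4) m_def[symmetric])
  qed (use r(3) in \<open>simp add: m_def\<close>)
  then obtain w where w: "\<And>z. z \<in> ball a r \<Longrightarrow> A z - cnj z = 0 \<Longrightarrow> z = w" by blast
  have "z = a" if "z \<in> ball a r" "A z = cnj z" for z
    using w[of z] w[of a] that r(1) assms(4) by simp
  with r(1) show ?thesis by (rule that)
qed

section \<open>Rational functions\<close>

text \<open>Coprimality prevents \<open>p\<close> from cancelling a root of \<open>q\<close>, so
  being a pole becomes a polynomial condition.\<close>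

lemma is_pole_rational_iff:
  fixes p q :: "complex poly"
  assumes "coprime p q" "q \<noteq> 0"
  shows "is_pole (\<lambda>z. poly p z / poly q z) a \<longleftrightarrow> poly q a = 0"
proof
  assume "poly q a = 0"
  moreover have "\<forall>\<^sub>F z in at a. poly q z \<noteq> 0"
  proof -
    have "open (- ({z. poly q z = 0} - {a}))"
      using poly_roots_finite[OF assms(2)] by (intro open_Compl finite_imp_closed) auto
    then show ?thesis
      unfolding eventually_at_topological
      by (intro exI[of _ "- ({z. poly q z = 0} - {a})"]) simp
  qed
  moreover have "(poly q \<longlongrightarrow> poly q a) (at a)"
    using poly_isCont[of a q] by (simp only: isCont_def)
  ultimately have "filterlim (poly q) (at 0) (at a)"
    by (simp add: filterlim_at)
  moreover have "poly p a \<noteq> 0"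
    using coprime_poly_0[OF assms(1), of a] \<open>poly q a = 0\<close> by simp
  ultimately show "is_pole (\<lambda>z. poly p z / poly q z) a"
    by (intro is_pole_divide poly_isCont)
next
  assume "is_pole (\<lambda>z. poly p z / poly q z) a"
  moreover have "((\<lambda>z. poly p z / poly q z) \<longlongrightarrow> poly p a / poly q a) (at a)" if "poly q a \<noteq> 0"
    using that by (intro tendsto_intros)
  ultimately show "poly q a = 0"
    using not_tendsto_and_filterlim_at_infinity[OF at_neq_bot] unfolding is_pole_def by metis
qed

lemma poly_map_cnj: "poly (map_poly cnj p) w = cnj (poly p (cnj w))"
  using poly_cnj[of p "cnj w"] by (simp only: complex_cnj_cnj)

text \<open>
  Let \<open>R\<^sup>*\<close> have the conjugate coefficients. Then \<open>R z = cnj z\<close> implies \<open>R\<^sup>* (R z) = z\<close>; with infinitely many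
  solutions this would be an identity, contradicting \<open>R' a = 0\<close> by the chain rule at \<open>a\<close>.
  Below, \<open>hom u\<close> clears the denominators in \<open>u\<^sup>* (p / q)\<close>.
\<close>

lemma finite_rational_eq_cnj:
  fixes p q :: "complex poly"
  defines "R \<equiv> \<lambda>z. poly p z / poly q z"
  assumes q: "poly q a \<noteq> 0" and fixed: "R a = cnj a" and crit: "deriv R a = 0"
  shows "finite {z. poly q z \<noteq> 0 \<and> R z = cnj z}" (is "finite ?Z")
proof (rule ccontr)
  assume inf: "infinite ?Z"
  define d where "d = max (degree p) (degree q)"
  define hom where "hom u = (\<Sum>i\<le>d. smult (cnj (coeff u i)) (p ^ i * q ^ (d - i)))" for u
  have hom: "poly (hom u) z = poly q z ^ d * poly (map_poly cnj u) (R z)"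
    if "degree u \<le> d" "poly q z \<noteq> 0" for u z
  proof -
    have summand: "poly p z ^ i * poly q z ^ (d - i) = poly q z ^ d * R z ^ i" if "i \<le> d" for i
    proof -
      have "poly p z ^ i = poly q z ^ i * R z ^ i"
        using \<open>poly q z \<noteq> 0\<close> by (simp add: R_def power_divide)
      moreover have "poly q z ^ i * poly q z ^ (d - i) = poly q z ^ d"
        using that by (simp flip: power_add)
      ultimately show ?thesis by (metis mult.commute mult.assoc)
    qed
    have "poly (hom u) z = (\<Sum>i\<le>d. cnj (coeff u i) * (poly p z ^ i * poly q z ^ (d - i)))"
      by (simp add: hom_def poly_sum)
    also have "\<dots> = (\<Sum>i\<le>d. poly q z ^ d * (cnj (coeff u i) * R z ^ i))"
      by (rule sum.cong) (simp_all add: summand)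
    also have "\<dots> = poly q z ^ d * (\<Sum>i\<le>d. cnj (coeff u i) * R z ^ i)"
      by (rule sum_distrib_left[symmetric])
    also have "(\<Sum>i\<le>d. cnj (coeff u i) * R z ^ i) = poly (map_poly cnj u) (R z)"
      unfolding poly_altdef using that(1)
      by (intro sum.mono_neutral_cong_right) (auto simp: coeff_map_poly degree_map_poly coeff_eq_0)
    finally show ?thesis .
  qed
  \<comment> \<open>At these points \<open>cnj (R z) = z\<close>, so evaluating the conjugated
    polynomial of \<open>u\<close> at \<open>R z\<close> yields \<open>cnj (poly u z)\<close>; the
    conjugate of \<open>p = R q\<close> then makes the two terms agree.\<close>
  have "poly (hom p - [:0, 1:] * hom q) z = 0" if "z \<in> ?Z" for z
  proof -
    have z: "poly q z \<noteq> 0" "cnj (R z) = z" using that by auto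
    then have "poly p z = R z * poly q z" by (simp add: R_def)
    then have "cnj (poly p z) = z * cnj (poly q z)" using z(2) by simp
    moreover have "poly (hom u) z = poly q z ^ d * cnj (poly u z)" if "degree u \<le> d" for u
      using hom[OF that z(1)] by (simp only: poly_map_cnj z(2))
    ultimately show ?thesis by (simp add: d_def)
  qed
  then have "?Z \<subseteq> {z. poly (hom p - [:0, 1:] * hom q) z = 0}" by blast
  with inf have "infinite {z. poly (hom p - [:0, 1:] * hom q) z = 0}"
    by (rule infinite_super[rotated])
  then have "hom p - [:0, 1:] * hom q = 0"
    by (rule contrapos_np) (rule poly_roots_finite)
  then have "poly (hom p - [:0, 1:] * hom q) z = 0" for z by (simp only: poly_0)
  then have hom_eq: "poly (hom p) z = z * poly (hom q) z" for z by simp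
  have id: "poly (map_poly cnj p) (R z) = z * poly (map_poly cnj q) (R z)" if "poly q z \<noteq> 0" for z
  proof -
    have "poly q z ^ d * poly (map_poly cnj p) (R z) = z * (poly q z ^ d * poly (map_poly cnj q) (R z))"
      using hom_eq[of z] hom[OF _ that] by (simp add: d_def)
    then have "poly q z ^ d * poly (map_poly cnj p) (R z) = poly q z ^ d * (z * poly (map_poly cnj q) (R z))"
      by (simp only: mult.left_commute)
    then show ?thesis using that by simp
  qed
  have "open {z. poly q z \<noteq> 0}"
    by (intro open_Collect_neq continuous_intros)
  have "(R has_field_derivative (poly (pderiv p) a * poly q a - poly p a * poly (pderiv q) a)
      / (poly q a * poly q a)) (at a)"
    unfolding R_def using q by (intro DERIV_divide poly_DERIV)
  note D = this
  have R: "(R has_field_derivative 0) (at a)"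
    using D DERIV_imp_deriv[OF D] crit by argo
  have DR: "((\<lambda>z. poly u (R z)) has_field_derivative 0) (at a)" for u
  proof -
    have "((\<lambda>z. poly u (R z)) has_field_derivative poly (pderiv u) (R a) * 0) (at a)"
      by (rule DERIV_chain2[where f = "poly u", OF poly_DERIV R])
    then show ?thesis by simp
  qed
  have "((\<lambda>z. z * poly (map_poly cnj q) (R z)) has_field_derivative
      1 * poly (map_poly cnj q) (R a) + 0 * a) (at a)"
    by (rule DERIV_mult[OF DERIV_ident DR])
  then have "((\<lambda>z. poly (map_poly cnj p) (R z)) has_field_derivative
      1 * poly (map_poly cnj q) (R a) + 0 * a) (at a)"
    by (rule has_field_derivative_transform_within_open[OF _ \<open>open {z. poly q z \<noteq> 0}\<close>]) (simp_all only: mem_Collect_eq q id not_False_eq_True)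
  \<comment> \<open>The left side has derivative \<open>0\<close> by the chain rule, the right side
    \<open>cnj (poly q a)\<close>, because \<open>cnj (R a) = a\<close>.\<close>
  from DERIV_unique[OF this DR] have "cnj (poly q a) = 0"
    by (simp only: poly_map_cnj fixed complex_cnj_cnj mult_zero_left mult_1 add_0_right)
  with q show False by simp
qed

text \<open>Outside \<open>V\<close> a point keeps distance \<open>\<delta>\<close> from
  \<open>a\<close>, so the perturbation is at most \<open>\<epsilon> / \<delta>\<close>. Growth at
  infinity excludes large points; on the compact rest the unperturbed equation fails by a fixed
  positive amount.\<close>

lemma perturbed_zeros_near_zeros:
  fixes p q :: "complex poly"
  defines "R \<equiv> \<lambda>z. poly p z / poly q z"
  assumes cop: "coprime p q"
    and lim: "filterlim (\<lambda>z. R z - cnj z) at_infinity at_infinity"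
    and V: "open V" "a \<in> V" "{z. poly q z \<noteq> 0 \<and> R z = cnj z} \<subseteq> V"
  shows "\<forall>\<^sub>F \<epsilon> in at_right 0. \<forall>z. poly q z \<noteq> 0 \<and> R z + of_real \<epsilon> / (z - a) = cnj z \<longrightarrow> z \<in> V"
proof -
  obtain M where M: "\<And>z. norm z \<ge> M \<Longrightarrow> 1 \<le> norm (R z - cnj z)"
  proof -
    have "\<forall>\<^sub>F z in at_infinity. 1 \<le> norm (R z - cnj z)"
      using filterlim_at_infinity[OF order_refl, THEN iffD1, OF lim] by simp
    then show ?thesis using that by (auto simp: eventually_at_infinity)
  qed
  obtain \<delta> where \<delta>: "\<delta> > 0" "ball a \<delta> \<subseteq> V" using V(1,2) by (rule openE)
  define K where "K = cball 0 M - V"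
  have "compact K" using V(1) by (simp add: K_def compact_diff)
  \<comment> \<open>Clearing the denominator makes the poles harmless: there \<open>h\<close> is nonzero by coprimality.\<close>
  define h where "h z = poly p z - cnj z * poly q z" for z
  have h_nz: "h z \<noteq> 0" if "z \<in> K" for z
  proof
    assume "h z = 0"
    moreover from this have "poly q z \<noteq> 0" using coprime_poly_0[OF cop, of z] by (auto simp: h_def)
    ultimately have "R z = cnj z" by (simp add: h_def R_def)
    with \<open>poly q z \<noteq> 0\<close> V(3) that show False by (auto simp: K_def)
  qed
  have "compact (h ` K)"
    unfolding h_def by (intro compact_continuous_image \<open>compact K\<close> continuous_intros)
  moreover have "0 \<notin> h ` K" using h_nz by force
  ultimately obtain \<mu> where \<mu>: "\<mu> > 0" "\<And>z. z \<in> K \<Longrightarrow> \<mu> \<le> norm (h z)"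
    using separate_point_closed[OF compact_imp_closed, of "h ` K" 0] by auto
  have "bounded (poly q ` K)"
    by (intro compact_imp_bounded compact_continuous_image \<open>compact K\<close> continuous_intros)
  then obtain B where B: "B > 0" "\<And>z. z \<in> K \<Longrightarrow> norm (poly q z) \<le> B"
    unfolding bounded_pos by blast
  \<comment> \<open>The first bound on \<open>\<epsilon>\<close> gives
    \<open>\<epsilon> / \<delta> < 1\<close>, against the lower bound outside radius
    \<open>M\<close>; the second gives \<open>B * \<epsilon> / \<delta> < \<mu>\<close>, against the
    lower bound for \<open>h\<close> on \<open>K\<close>.\<close>
  have "z \<in> V" if \<epsilon>: "0 < \<epsilon>" "\<epsilon> < min \<delta> (\<mu> * \<delta> / B)" and z: "poly q z \<noteq> 0" "R z + of_real \<epsilon> / (z - a) = cnj z"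
    for \<epsilon> z
  proof (rule ccontr)
    assume "z \<notin> V"
    then have "\<delta> \<le> norm (z - a)" using \<delta>(2) by (force simp: dist_norm norm_minus_commute)
    then have pert: "norm (of_real \<epsilon> / (z - a)) \<le> \<epsilon> / \<delta>"
      using \<delta>(1) \<epsilon>(1) by (simp add: norm_divide frac_le)
    have eq: "R z - cnj z = - (of_real \<epsilon> / (z - a))" using z(2) by (simp add: algebra_simps)
    have "norm z < M"
    proof (rule ccontr)
      assume "\<not> norm z < M"
      then have "1 \<le> norm (R z - cnj z)" using M by simp
      also have "\<dots> \<le> \<epsilon> / \<delta>" using pert by (simp only: eq norm_minus_cancel)
      also have "\<dots> < 1" using \<epsilon> \<delta>(1) by simp
      finally show False by simp
    qed
    with \<open>z \<notin> V\<close> have "z \<in> K" by (simp add: K_def)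
    have "h z = poly q z * (R z - cnj z)" using z(1) by (simp add: h_def R_def field_simps)
    then have "\<mu> \<le> norm (poly q z) * norm (of_real \<epsilon> / (z - a))"
      using \<mu>(2)[OF \<open>z \<in> K\<close>] by (simp only: eq norm_mult norm_minus_cancel)
    also have "\<dots> \<le> B * (\<epsilon> / \<delta>)"
      using B \<open>z \<in> K\<close> pert by (intro mult_mono) auto
    also have "\<dots> < \<mu>" using \<epsilon> \<delta>(1) B(1) by (simp add: field_simps)
    finally show False by simp
  qed
  then show ?thesis
    using \<delta>(1) \<mu>(1) B(1) unfolding eventually_at_right_field
    by (intro exI[of _ "min \<delta> (\<mu> * \<delta> / B)"]) auto
qed

section \<open>Zeros near a critical zero\<close>

text \<open>The factor left after removing the zero of order \<open>m\<close> has no zeros on a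
  disk, hence has a holomorphic logarithm there; this makes its roots available.\<close>

lemma holomorphic_critical_local_form:
  fixes R :: "complex \<Rightarrow> complex"
  assumes "R holomorphic_on U" "open U" "a \<in> U" "m > 0"
    and "\<And>k. 0 < k \<Longrightarrow> k < m \<Longrightarrow> (deriv ^^ k) R a = 0" "(deriv ^^ m) R a \<noteq> 0"
  obtains r l where "r > 0" "ball a r \<subseteq> U" "l holomorphic_on ball a r"
    "\<And>z. z \<in> ball a r \<Longrightarrow> R z = R a + (z - a) ^ m * exp (l z)"
proof -
  obtain g r where g: "r > 0" "g holomorphic_on ball a r"
      "\<And>z. z \<in> ball a r \<Longrightarrow> R z - R a = (z - a) ^ m * g z"
      "\<And>z. z \<in> ball a r \<Longrightarrow> g z \<noteq> 0"
    by (rule holomorphic_factor_order_of_zero[OF assms(1-4) assms(6)]) (use assms(5) in blast)+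
  obtain l where l: "l holomorphic_on ball a r" "\<And>z. z \<in> ball a r \<Longrightarrow> exp (l z) = g z"
    using g(1) by (auto intro: holomorphic_logarithm_exists[OF convex_ball open_ball g(2,4), of a])
  obtain r' where r': "r' > 0" "ball a r' \<subseteq> U" using assms(2,3) by (rule openE)
  show ?thesis
  proof (rule that[of "min r r'" l])
    show "l holomorphic_on ball a (min r r')"
      using l(1) by (rule holomorphic_on_subset) auto
    fix z assume "z \<in> ball a (min r r')"
    then have "z \<in> ball a r" by simp
    from g(3)[OF this] l(2)[OF this] show "R z = R a + (z - a) ^ m * exp (l z)"
      by (simp add: algebra_simps)
  qed (use g(1) r' in auto)
qed

text \<open>\<open>\<psi>\<close> is an \<open>n\<close>-th root of
  \<open>H = (z - a) * (R z - R a)\<close> and serves as local coordinate. The left side in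
  \<open>euler\<close> is \<open>(z - a) * deriv H z\<close>, so that condition is an approximate
  Euler identity for homogeneity of degree \<open>n\<close>.\<close>

locale critical_zero =
  fixes R \<psi> :: "complex \<Rightarrow> complex" and a :: complex and n :: nat and \<delta> :: real
  assumes n_ge: "n \<ge> 3" and \<delta>_pos: "\<delta> > 0" and zero: "R a = cnj a"
    and holo: "R holomorphic_on ball a \<delta>"
    and \<psi>_holo: "\<psi> holomorphic_on ball a \<delta>" and \<psi>_inj: "inj_on \<psi> (ball a \<delta>)" and \<psi>_0: "\<psi> a = 0"
    and \<psi>_power: "\<And>z. z \<in> ball a \<delta> \<Longrightarrow> (z - a) * (R z - R a) = \<psi> z ^ n"
    and \<psi>_small: "\<And>z. z \<in> ball a \<delta> \<Longrightarrow> z \<noteq> a \<Longrightarrow> norm (\<psi> z ^ n) < (norm (z - a))\<^sup>2 / n"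
    and euler: "\<And>z. z \<in> ball a \<delta> \<Longrightarrow>
      \<exists>w. norm (w - of_nat n) < 1 / 2 \<and> (z - a)\<^sup>2 * deriv R z + \<psi> z ^ n = w * \<psi> z ^ n"

text \<open>From \<open>H = (z - a) ^ n * exp l\<close> comes the root
  \<open>(z - a) * exp (l / n)\<close>, whose derivative at \<open>a\<close> is nonzero. The
  smallness holds because \<open>H / (z - a) ^ 2\<close> retains the factor
  \<open>(z - a) ^ (n - 2)\<close>, and \<open>n \<ge> 3\<close>.\<close>

lemma critical_zero_exists:
  fixes R :: "complex \<Rightarrow> complex"
  assumes "R holomorphic_on U" "open U" "a \<in> U" "R a = cnj a" "n \<ge> 3"
    and "\<forall>k\<in>{1..n - 2}. (deriv ^^ k) R a = 0" "(deriv ^^ (n - 1)) R a \<noteq> 0"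
  obtains \<psi> \<delta> where "critical_zero R \<psi> a n \<delta>" "ball a \<delta> \<subseteq> U"
proof -
  obtain r l where r: "r > 0" "ball a r \<subseteq> U" and l: "l holomorphic_on ball a r"
    and R: "\<And>z. z \<in> ball a r \<Longrightarrow> R z = R a + (z - a) ^ (n - 1) * exp (l z)"
  proof (rule holomorphic_critical_local_form[OF assms(1-3) _ _ assms(7)])
    show "0 < n - 1" using \<open>n \<ge> 3\<close> by simp
    show "(deriv ^^ k) R a = 0" if "0 < k" "k < n - 1" for k
      using assms(6) that by simp
  qed (rule that)
  obtain m where m: "n = Suc (Suc (Suc m))"
    using \<open>n \<ge> 3\<close> that[of "n - 3"] by simp
  define \<psi> where "\<psi> z = (z - a) * exp (l z / of_nat n)" for z
  have \<psi>: "\<psi> holomorphic_on ball a r"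
    unfolding \<psi>_def using l m by (intro holomorphic_intros) auto
  have power: "\<psi> z ^ n = (z - a) ^ n * exp (l z)" for z
  proof -
    have "exp (l z / of_nat n) ^ n = exp (of_nat n * (l z / of_nat n))"
      by (rule exp_of_nat_mult[symmetric])
    also have "of_nat n * (l z / of_nat n) = l z" using m by (simp only: nonzero_mult_div_cancel_left of_nat_neq_0 times_divide_eq_right not_False_eq_True)
    finally show ?thesis by (simp only: \<psi>_def power_mult_distrib)
  qed
  have a: "a \<in> ball a r" using r by simp
  have dl: "(l has_field_derivative deriv l z) (at z)" if "z \<in> ball a r" for z
    using l that by (intro holomorphic_derivI) auto
  have "(\<psi> has_field_derivative exp (l a / of_nat n)) (at a)"
  proof -
    have "((\<lambda>z. exp (l z / of_nat n)) has_field_derivative exp (l a / of_nat n) * (deriv l a / of_nat n)) (at a)"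
      by (rule DERIV_chain2[OF DERIV_exp DERIV_cdivide[OF dl[OF a]]])
    from DERIV_mult[OF DERIV_diff[OF DERIV_ident DERIV_const[of a]] this] show ?thesis
      unfolding \<psi>_def by simp
  qed
  then have "deriv \<psi> a \<noteq> 0" by (simp add: DERIV_imp_deriv)
  then obtain s where s: "s > 0" "ball a s \<subseteq> ball a r" "inj_on \<psi> (ball a s)"
    by (rule has_complex_derivative_locally_injective[OF \<psi> a open_ball])
  have cont: "isCont l a" "isCont (deriv l) a"
    using l a holomorphic_deriv[OF l open_ball]
    by (meson continuous_on_eq_continuous_at holomorphic_on_imp_continuous_on open_ball)+
  have "((\<lambda>z. norm ((z - a) ^ Suc m * exp (l z))) \<longlongrightarrow> norm ((a - a) ^ Suc m * exp (l a))) (at a)"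
    using cont(1) unfolding isCont_def by (intro tendsto_intros)
  then have "((\<lambda>z. norm ((z - a) ^ Suc m * exp (l z))) \<longlongrightarrow> 0) (at a)" by simp
  then have "\<forall>\<^sub>F z in at a. norm ((z - a) ^ Suc m * exp (l z)) < 1 / n"
    using m by (intro order_tendstoD) auto
  moreover have "((\<lambda>z. norm ((z - a) * deriv l z)) \<longlongrightarrow> norm ((a - a) * deriv l a)) (at a)"
    using cont(2) unfolding isCont_def by (intro tendsto_intros)
  then have "((\<lambda>z. norm ((z - a) * deriv l z)) \<longlongrightarrow> 0) (at a)" by simp
  then have "\<forall>\<^sub>F z in at a. norm ((z - a) * deriv l z) < 1 / 2"
    by (intro order_tendstoD) auto
  ultimately have "\<forall>\<^sub>F z in at a. norm ((z - a) ^ Suc m * exp (l z)) < 1 / n \<and>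
      norm ((z - a) * deriv l z) < 1 / 2"
    by (rule eventually_conj)
  then obtain t where t: "t > 0" "\<And>z. z \<noteq> a \<Longrightarrow> dist z a < t \<Longrightarrow>
      norm ((z - a) ^ Suc m * exp (l z)) < 1 / n \<and> norm ((z - a) * deriv l z) < 1 / 2"
    unfolding eventually_at by auto
  define \<delta> where "\<delta> = min s t"
  have sub: "ball a \<delta> \<subseteq> ball a s" "ball a \<delta> \<subseteq> ball a r" "ball a \<delta> \<subseteq> U"
    using s(2) r(2) by (auto simp: \<delta>_def subset_iff)
  have "critical_zero R \<psi> a n \<delta>"
  proof
    show "R holomorphic_on ball a \<delta>" using assms(1) sub(3) by (rule holomorphic_on_subset)
    show "\<psi> holomorphic_on ball a \<delta>" using \<psi> sub(2) by (rule holomorphic_on_subset)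
    show "inj_on \<psi> (ball a \<delta>)" using s(3) sub(1) by (rule inj_on_subset)
    fix z assume z: "z \<in> ball a \<delta>"
    then have zr: "z \<in> ball a r" using sub by blast
    show "(z - a) * (R z - R a) = \<psi> z ^ n"
      unfolding power R[OF zr] by (simp add: m)
    show "norm (\<psi> z ^ n) < (norm (z - a))\<^sup>2 / n" if "z \<noteq> a"
    proof -
      have "norm ((z - a) ^ Suc m * exp (l z)) < 1 / n"
        using t(2)[OF that] z by (simp add: \<delta>_def dist_commute)
      then have "(norm (z - a))\<^sup>2 * norm ((z - a) ^ Suc m * exp (l z)) < (norm (z - a))\<^sup>2 * (1 / n)"
        using that by (intro mult_strict_left_mono) auto
      moreover have "norm (\<psi> z ^ n) = (norm (z - a))\<^sup>2 * norm ((z - a) ^ Suc m * exp (l z))"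
        unfolding power by (simp add: m norm_mult norm_power power2_eq_square)
      ultimately show ?thesis by simp
    qed
    \<comment> \<open>This is \<open>z - a\<close> times the logarithmic derivative of
      \<open>(z - a) ^ n * exp (l z)\<close>.\<close>
    define w where "w = of_nat n + (z - a) * deriv l z"
    have "norm (w - of_nat n) < 1 / 2"
      using t(2)[of z] z by (cases "z = a") (simp_all add: w_def \<delta>_def dist_commute)
    moreover have "(z - a)\<^sup>2 * deriv R z + \<psi> z ^ n = w * \<psi> z ^ n"
    proof -
      have "((\<lambda>z. R a + (z - a) ^ (n - 1) * exp (l z)) has_field_derivative
          of_nat (n - 1) * (z - a) ^ (n - 2) * exp (l z) + (z - a) ^ (n - 1) * (exp (l z) * deriv l z)) (at z)"
        by (rule derivative_eq_intros dl[OF zr] refl | simp add: m algebra_simps)+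
      then have "(R has_field_derivative
          of_nat (n - 1) * (z - a) ^ (n - 2) * exp (l z) + (z - a) ^ (n - 1) * (exp (l z) * deriv l z)) (at z)"
        using zr R by (auto elim!: has_field_derivative_transform_within_open[where S = "ball a r"])
      note DERIV_imp_deriv[OF this]
      moreover have "x\<^sup>2 * (of_nat (n - 1) * x ^ (n - 2) * E + x ^ (n - 1) * (E * L)) + x ^ n * E
          = (of_nat n + x * L) * (x ^ n * E)" for x E L :: complex
        by (simp add: m power2_eq_square algebra_simps)
      ultimately show ?thesis unfolding power w_def by simp
    qed
    ultimately show "\<exists>w. norm (w - of_nat n) < 1 / 2 \<and> (z - a)\<^sup>2 * deriv R z + \<psi> z ^ n = w * \<psi> z ^ n"
      by blast
  qed (use assms s(1) t(1) in \<open>auto simp: \<delta>_def \<psi>_def\<close>)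
  then show ?thesis using sub(3) by (rule that)
qed

lemma norm_unit_root:
  fixes u :: complex
  assumes "u ^ n = of_real s" "\<bar>s\<bar> = 1" "n > 0"
  shows "norm u = 1"
proof -
  have "norm u ^ n = 1 ^ n"
    using arg_cong[OF assms(1), of norm] assms(2) by (simp add: norm_power)
  then show ?thesis using assms(3) power_eq_imp_eq_base[of "norm u" n 1] by simp
qed

context critical_zero
begin

section \<open>Position and orientation of the perturbed zeros\<close>

text \<open>Multiply by \<open>z - a\<close>. Because \<open>R a = cnj a\<close>, the product
  \<open>(z - a) * cnj z\<close> is \<open>(z - a) * R a\<close> plus the squared distance, and the
  terms with \<open>R a\<close> cancel. The value \<open>\<epsilon> = 0\<close> recovers the
  unperturbed equation.\<close>

lemma perturbed_eq_cnj_iff: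
  assumes "z \<in> ball a \<delta>" "z \<noteq> a"
  shows "R z + of_real \<epsilon> / (z - a) = cnj z \<longleftrightarrow> \<psi> z ^ n = of_real ((norm (z - a))\<^sup>2 - \<epsilon>)"
proof -
  have sq: "(z - a) * cnj z = (z - a) * R a + of_real ((norm (z - a))\<^sup>2)"
    unfolding zero by (simp add: complex_norm_square algebra_simps del: of_real_power)
  have "R z + of_real \<epsilon> / (z - a) = cnj z \<longleftrightarrow> (z - a) * (R z + of_real \<epsilon> / (z - a)) = (z - a) * cnj z"
    using assms(2) by simp
  also have "(z - a) * (R z + of_real \<epsilon> / (z - a)) = \<psi> z ^ n + (z - a) * R a + of_real \<epsilon>"
  proof -
    have "(z - a) * (R z + of_real \<epsilon> / (z - a)) = (z - a) * R z + of_real \<epsilon>"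
      using assms(2) by (simp add: distrib_left)
    also have "(z - a) * R z = \<psi> z ^ n + (z - a) * R a"
      unfolding \<psi>_power[OF assms(1), symmetric] by (simp add: algebra_simps)
    finally show ?thesis .
  qed
  also have "\<dots> = (z - a) * cnj z \<longleftrightarrow> \<psi> z ^ n = of_real ((norm (z - a))\<^sup>2 - \<epsilon>)"
    unfolding sq by (simp add: algebra_simps)
  finally show ?thesis .
qed

text \<open>Another solution would make \<open>norm (\<psi> z ^ n)\<close> equal to the squared
  distance, against \<open>\<psi>_small\<close>.\<close>

lemma eq_cnj_imp_eq_centre:
  assumes "z \<in> ball a \<delta>" "R z = cnj z"
  shows "z = a"
proof (rule ccontr)
  assume "z \<noteq> a"
  then have "\<psi> z ^ n = of_real ((norm (z - a))\<^sup>2)"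
    using perturbed_eq_cnj_iff[OF assms(1), of 0] assms(2) by simp
  then have "norm (\<psi> z ^ n) = (norm (z - a))\<^sup>2" by (simp only: norm_of_real abs_power2)
  with \<psi>_small[OF assms(1) \<open>z \<noteq> a\<close>] have "(norm (z - a))\<^sup>2 < (norm (z - a))\<^sup>2 / n"
    by simp
  also have "\<dots> \<le> (norm (z - a))\<^sup>2 / 1"
    using n_ge by (intro divide_left_mono) auto
  finally show False by simp
qed

context
  fixes \<epsilon> :: real and z :: complex
  assumes z: "z \<in> ball a \<delta>" "z \<noteq> a" and sol: "R z + of_real \<epsilon> / (z - a) = cnj z"
begin

lemma perturbed_zero_power: "\<psi> z ^ n = of_real ((norm (z - a))\<^sup>2 - \<epsilon>)"
  using perturbed_eq_cnj_iff[OF z] sol by simp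

lemma perturbed_zero_small: "\<bar>(norm (z - a))\<^sup>2 - \<epsilon>\<bar> < (norm (z - a))\<^sup>2 / n"
  using \<psi>_small[OF z] unfolding perturbed_zero_power by (simp only: norm_of_real)

text \<open>Otherwise \<open>\<psi> z = 0\<close>, which injectivity allows only at
  \<open>a\<close>. This leaves just the two cases of the orientation lemma.\<close>

lemma perturbed_zero_sq_neq: "(norm (z - a))\<^sup>2 \<noteq> \<epsilon>"
proof
  assume "(norm (z - a))\<^sup>2 = \<epsilon>"
  then have "\<psi> z ^ n = 0" using perturbed_zero_power by simp
  then have "\<psi> z = \<psi> a" by (simp add: \<psi>_0)
  with \<psi>_inj z \<delta>_pos show False by (auto dest: inj_onD)
qed

text \<open>With \<open>x\<close> the squared distance, \<open>abs (x - \<epsilon>) < x / n\<close>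
  gives \<open>n / (n + 1) * \<epsilon> < x < n / (n - 1) * \<epsilon>\<close>. The upper bound is
  \<open>\<eta> ^ 2 * \<epsilon>\<close>; the lower one exceeds
  \<open>\<epsilon> / \<eta> ^ 2\<close>, since \<open>(n - 1) * (n + 1) < n ^ 2\<close>.\<close>

lemma perturbed_zero_annulus:
  assumes "\<epsilon> > 0" and \<eta>: "\<eta> = sqrt (real n / (real n - 1))"
  shows "sqrt \<epsilon> / \<eta> < norm (z - a)" "norm (z - a) < \<eta> * sqrt \<epsilon>"
proof -
  have n: "real n \<ge> 3" using n_ge by simp
  have \<eta>_sq: "\<eta> > 0" "\<eta>\<^sup>2 = real n / (real n - 1)" unfolding \<eta> using n by simp_all
  define x where "x = (norm (z - a))\<^sup>2"
  have x: "x > 0" "x - \<epsilon> < x / n" "\<epsilon> - x < x / n"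
    using z perturbed_zero_small unfolding x_def abs_less_iff by simp_all
  have "(x - \<epsilon>) * real n < x" using pos_less_divide_eq[of "real n"] x(2) n by simp
  then have "x * (real n - 1) < \<epsilon> * real n"
    by (simp only: left_diff_distrib right_diff_distrib mult_1_right)
  then have "x < \<epsilon> * \<eta>\<^sup>2"
    unfolding \<eta>_sq(2) times_divide_eq_right using pos_less_divide_eq[of "real n - 1"] n by simp
  then have "(norm (z - a))\<^sup>2 < (\<eta> * sqrt \<epsilon>)\<^sup>2"
    using \<open>\<epsilon> > 0\<close> by (simp add: x_def power_mult_distrib mult.commute)
  then show "norm (z - a) < \<eta> * sqrt \<epsilon>"
    by (rule power2_less_imp_less) (use \<eta>_sq(1) \<open>\<epsilon> > 0\<close> in simp)
  have "(\<epsilon> - x) * real n < x" using pos_less_divide_eq[of "real n"] x(3) n by simp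
  then have "\<epsilon> * real n < x * (real n + 1)"
    by (simp only: left_diff_distrib distrib_left mult_1_right)
  then have "(real n - 1) * (\<epsilon> * real n) < (real n - 1) * (x * (real n + 1))"
    using n by (intro mult_strict_left_mono) auto
  also have "\<dots> = x * (real n * real n) - x"
    by (simp only: left_diff_distrib right_diff_distrib distrib_left distrib_right mult_1_left mult_1_right mult_ac)
  also have "\<dots> < real n * (x * real n)" using x(1) by (simp add: mult_ac)
  finally have "real n * (\<epsilon> * (real n - 1)) < real n * (x * real n)"
    by (simp only: mult_ac)
  then have "\<epsilon> * (real n - 1) < x * real n" using n by (subst (asm) mult_less_cancel_left_pos) auto
  then have "\<epsilon> / \<eta>\<^sup>2 < x"
    unfolding \<eta>_sq(2) divide_divide_eq_right using n by (subst pos_divide_less_eq) auto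
  then have "(sqrt \<epsilon> / \<eta>)\<^sup>2 < (norm (z - a))\<^sup>2"
    using \<open>\<epsilon> > 0\<close> by (simp add: x_def power_divide)
  then show "sqrt \<epsilon> / \<eta> < norm (z - a)" by (rule power2_less_imp_less) simp
qed

lemma perturbed_zero_deriv:
  "deriv (\<lambda>z. R z + of_real \<epsilon> / (z - a)) z = deriv R z - of_real \<epsilon> / (z - a)\<^sup>2"
proof (rule DERIV_imp_deriv)
  have "(R has_field_derivative deriv R z) (at z)"
    using holo z(1) by (intro holomorphic_derivI) auto
  from DERIV_add[OF this DERIV_divide[OF DERIV_const DERIV_diff[OF DERIV_ident DERIV_const]], of a "of_real \<epsilon>"]
  show "((\<lambda>z. R z + of_real \<epsilon> / (z - a)) has_field_derivative
      deriv R z - of_real \<epsilon> / (z - a)\<^sup>2) (at z)"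
    using z(2) by (simp add: power2_eq_square)
qed

text \<open>
  At a zero, \<open>(z - a)\<^sup>2 (R' z - \<epsilon> / (z - a)\<^sup>2) = w H - \<bar>z - a\<bar>\<^sup>2\<close> with \<open>H = \<bar>z - a\<bar>\<^sup>2 - \<epsilon>\<close> real and \<open>w\<close> close to \<open>n\<close>,
  so the sign of \<open>H\<close> decides the orientation.
\<close>

lemma perturbed_zero_orientation:
  defines "A \<equiv> \<lambda>z. R z + of_real \<epsilon> / (z - a)"
  shows "(norm (z - a))\<^sup>2 < \<epsilon> \<Longrightarrow> norm (deriv A z) > 1"
    and "(norm (z - a))\<^sup>2 > \<epsilon> \<Longrightarrow> norm (deriv A z) < 1"
proof -
  define x where "x = (norm (z - a))\<^sup>2"
  define v where "v = (x - \<epsilon>) / x"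
  have "x > 0" using z(2) by (simp add: x_def)
  obtain w where w: "norm (w - of_nat n) < 1 / 2" "(z - a)\<^sup>2 * deriv R z + \<psi> z ^ n = w * \<psi> z ^ n"
    using euler[OF z(1)] by blast
  have "(z - a)\<^sup>2 * deriv A z = (z - a)\<^sup>2 * deriv R z - of_real \<epsilon>"
    unfolding A_def perturbed_zero_deriv using z(2) by (simp add: right_diff_distrib)
  also have "\<dots> = w * of_real (x - \<epsilon>) - of_real (x - \<epsilon>) - of_real \<epsilon>"
    using w(2) unfolding perturbed_zero_power x_def[symmetric] by (simp add: algebra_simps)
  also have "\<dots> = of_real x * (w * of_real v - 1)"
    using \<open>x > 0\<close> by (simp add: v_def field_simps)
  finally have "norm ((z - a)\<^sup>2 * deriv A z) = norm (of_real x * (w * of_real v - 1))"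
    by (rule arg_cong)
  then have "x * norm (deriv A z) = x * norm (w * of_real v - 1)"
    using \<open>x > 0\<close> by (simp add: norm_mult norm_power x_def)
  then have "norm (deriv A z) = norm (w * of_real v - 1)" using \<open>x > 0\<close> by simp
  \<comment> \<open>Whether this exceeds \<open>1\<close> depends on the sign of \<open>v\<close>
    alone once the bracket is known to be positive.\<close>
  moreover have "(norm (w * of_real v - 1))\<^sup>2 = 1 - v * (2 * Re w - v * (norm w)\<^sup>2)"
    by (simp only: cmod_power2) (simp add: power2_eq_square algebra_simps)
  ultimately have norm_sq: "(norm (deriv A z))\<^sup>2 = 1 - v * (2 * Re w - v * (norm w)\<^sup>2)" by simp
  have Re_w: "Re w > real n - 1 / 2"
    using abs_Re_le_cmod[of "w - of_nat n"] w(1) by simp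
  have norm_w: "norm w < real n + 1 / 2"
    using norm_triangle_ineq[of "w - of_nat n" "of_nat n"] w(1) by simp
  {
    assume "(norm (z - a))\<^sup>2 < \<epsilon>"
    then have "v < 0" using \<open>x > 0\<close> by (simp add: v_def x_def divide_neg_pos)
    then have "v * (norm w)\<^sup>2 \<le> 0" by (simp add: mult_le_0_iff)
    then have "0 < 2 * Re w - v * (norm w)\<^sup>2" using Re_w n_ge by linarith
    with \<open>v < 0\<close> have "1\<^sup>2 < (norm (deriv A z))\<^sup>2"
      unfolding norm_sq by (simp add: mult_neg_pos)
    then show "norm (deriv A z) > 1" by (rule power2_less_imp_less) simp
  }
  assume "(norm (z - a))\<^sup>2 > \<epsilon>"
  then have "v > 0" using \<open>x > 0\<close> by (simp add: v_def x_def)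
  have "x - \<epsilon> < x / n" using perturbed_zero_small unfolding x_def by linarith
  then have "v < 1 / n" using \<open>x > 0\<close> by (simp add: v_def divide_less_eq)
  \<comment> \<open>The estimates \<open>v < 1 / n\<close> and \<open>norm w < n + 1 / 2\<close>
    bound this by \<open>n + 2\<close>, while \<open>2 * Re w > 2 * n - 1\<close>; the comparison
    uses \<open>n \<ge> 3\<close>.\<close>
  have "v * (norm w)\<^sup>2 \<le> 1 / n * (real n + 1 / 2)\<^sup>2"
    using \<open>v < 1 / n\<close> \<open>v > 0\<close> norm_w by (intro mult_mono power_mono) auto
  also have "\<dots> = real n + 1 + 1 / (4 * n)"
    using n_ge by (simp add: power2_eq_square field_simps)
  also have "\<dots> \<le> real n + 1 + 1" using n_ge by (simp add: field_simps)
  also have "\<dots> < 2 * Re w" using Re_w n_ge by linarith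
  finally have "0 < 2 * Re w - v * (norm w)\<^sup>2" by simp
  with \<open>v > 0\<close> have "(norm (deriv A z))\<^sup>2 < 1\<^sup>2"
    unfolding norm_sq by simp
  then show "norm (deriv A z) < 1" by (rule power2_less_imp_less) simp
qed

end

section \<open>Counting the zeros near the critical zero\<close>

text \<open>The zeros are regular, hence isolated, and compactness makes them finite. Counting needs
  this, since \<open>card\<close> of an infinite set is \<open>0\<close>.\<close>

lemma finite_perturbed_zeros:
  assumes "\<epsilon> > 0" "\<rho> < \<delta>"
  shows "finite {z \<in> cball a \<rho>. z \<noteq> a \<and> R z + of_real \<epsilon> / (z - a) = cnj z}" (is "finite ?Z")
proof -
  have sub: "cball a \<rho> \<subseteq> ball a \<delta>" using assms(2) by auto
  have "continuous_on (cball a \<rho>) (\<lambda>z. \<psi> z ^ n - of_real ((norm (z - a))\<^sup>2 - \<epsilon>))"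
    using \<psi>_holo sub
    by (intro continuous_intros continuous_on_subset[OF holomorphic_on_imp_continuous_on])
  then have "closed {z \<in> cball a \<rho>. \<psi> z ^ n - of_real ((norm (z - a))\<^sup>2 - \<epsilon>) = 0}"
    by (intro continuous_closed_preimage_constant) auto
  also have "{z \<in> cball a \<rho>. \<psi> z ^ n - of_real ((norm (z - a))\<^sup>2 - \<epsilon>) = 0} = ?Z"
  proof -
    \<comment> \<open>At the centre the multiplied equation reads \<open>0 = - \<epsilon>\<close>,
      so its closed solution set omits \<open>a\<close> by itself.\<close>
    have "\<psi> a ^ n - of_real ((norm (a - a))\<^sup>2 - \<epsilon>) \<noteq> 0"
      using assms(1) n_ge by (simp add: \<psi>_0 zero_power)
    moreover have "\<psi> z ^ n - of_real ((norm (z - a))\<^sup>2 - \<epsilon>) = 0 \<longleftrightarrow> R z + of_real \<epsilon> / (z - a) = cnj z"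
      if "z \<in> cball a \<rho>" "z \<noteq> a" for z
      unfolding perturbed_eq_cnj_iff[OF subsetD[OF sub that(1)] that(2)] by (rule right_minus_eq)
    ultimately show ?thesis by (intro Collect_cong) blast
  qed
  finally have "compact ?Z"
    unfolding compact_eq_bounded_closed by (auto intro: bounded_subset[OF bounded_cball])
  moreover have "\<not> z islimpt ?Z" if "z \<in> ?Z" for z
  proof -
    have z: "z \<in> ball a \<delta>" "z \<noteq> a" "R z + of_real \<epsilon> / (z - a) = cnj z" using that sub by auto
    define A where "A = (\<lambda>z. R z + of_real \<epsilon> / (z - a))"
    have holo_A: "A holomorphic_on ball a \<delta> - {a}"
      unfolding A_def using holo by (intro holomorphic_intros) (auto intro: holomorphic_on_subset)
    have reg: "norm (deriv A z) \<noteq> 1"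
      using perturbed_zero_orientation[OF z] perturbed_zero_sq_neq[OF z] unfolding A_def by linarith
    have dom: "open (ball a \<delta> - {a})" "z \<in> ball a \<delta> - {a}" "A z = cnj z"
      using z by (auto simp: A_def open_delete)
    obtain r where r: "r > 0" "\<And>y. y \<in> ball z r \<Longrightarrow> A y = cnj y \<Longrightarrow> y = z"
      by (rule regular_zero_isolated[OF holo_A dom reg]) (rule that; blast)
    show ?thesis
    proof
      assume "z islimpt ?Z"
      then obtain y where y: "y \<in> ?Z" "y \<noteq> z" "dist y z < r"
        using r(1) unfolding islimpt_approachable by blast
      with r(2)[of y] show False by (simp add: A_def dist_commute)
    qed
  qed
  ultimately have "finite (?Z \<inter> ?Z)" by (intro finite_not_islimpt_in_compact) auto
  then show ?thesis by simp
qed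

text \<open>
  Along the curve \<open>t \<mapsto> \<psi>\<^sup>-\<^sup>1 (t u)\<close> the equation becomes \<open>\<bar>\<zeta>\<bar>\<^sup>2 - s t ^ n = \<epsilon>\<close>, solved by the intermediate value theorem.
\<close>

lemma perturbed_zero_on_ray:
  assumes "0 < \<rho>" "\<rho> \<le> \<delta>" "u ^ n = of_real s" "\<bar>s\<bar> = 1"
  shows "\<forall>\<^sub>F \<epsilon> in at_right 0. \<exists>z \<in> ball a \<rho> - {a}. \<exists>t>0. \<psi> z = of_real t * u \<and>
    R z + of_real \<epsilon> / (z - a) = cnj z \<and> 0 < s * ((norm (z - a))\<^sup>2 - \<epsilon>)"
proof -
  have u: "norm u = 1" using assms(3,4) n_ge by (intro norm_unit_root) auto
  have sub: "ball a \<rho> \<subseteq> ball a \<delta>" using assms(2) by auto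
  have \<psi>: "\<psi> holomorphic_on ball a \<rho>" "inj_on \<psi> (ball a \<rho>)"
    using \<psi>_holo \<psi>_inj sub by (auto intro: holomorphic_on_subset inj_on_subset)
  obtain \<phi> where \<phi>: "\<phi> holomorphic_on \<psi> ` ball a \<rho>" "\<And>z. z \<in> ball a \<rho> \<Longrightarrow> \<phi> (\<psi> z) = z"
    by (rule holomorphic_has_inverse[OF \<psi>(1) open_ball \<psi>(2)]) (rule that)
  have "open (\<psi> ` ball a \<rho>)" using open_mapping_thm3[OF \<psi>(1) open_ball \<psi>(2)] .
  note nbhd = this[unfolded open_contains_cball]
  have "0 \<in> \<psi> ` ball a \<rho>" using \<psi>_0 assms(1) by (metis centre_in_ball imageI)
  from bspec[OF nbhd this] obtain \<tau> where \<tau>: "\<tau> > 0" "cball 0 \<tau> \<subseteq> \<psi> ` ball a \<rho>"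
    by (elim exE conjE) (rule that)
  have ray: "of_real t * u \<in> \<psi> ` ball a \<rho>" if "t \<in> {0..\<tau>}" for t
    using \<tau>(2) that u by (auto simp: norm_mult)
  define g where "g t = (norm (\<phi> (of_real t * u) - a))\<^sup>2 - s * t ^ n" for t
  have "continuous_on {0..\<tau>} g"
    unfolding g_def using ray
    by (intro continuous_intros continuous_on_compose2[OF holomorphic_on_imp_continuous_on[OF \<phi>(1)]]) auto
  have solves: "\<phi> (of_real t * u) \<in> ball a \<rho> - {a} \<and> \<psi> (\<phi> (of_real t * u)) = of_real t * u"
    if t: "0 < t" "t \<le> \<tau>" for t
  proof -
    obtain z where z: "z \<in> ball a \<rho>" "of_real t * u = \<psi> z" using ray[of t] t by auto
    moreover have "z \<noteq> a" using z(2) t(1) u \<psi>_0 by auto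
    ultimately show ?thesis using \<phi>(2) by simp
  qed
  have power: "(of_real t * u) ^ n = of_real (s * t ^ n)" for t
    using assms(3) by (simp add: power_mult_distrib)
  have "g 0 = 0" using \<phi>(2)[of a] assms(1) n_ge by (simp add: g_def \<psi>_0)
  moreover have "g \<tau> > 0"
  proof -
    define z where "z = \<phi> (of_real \<tau> * u)"
    have z: "z \<in> ball a \<delta>" "z \<noteq> a" "\<psi> z ^ n = of_real (s * \<tau> ^ n)"
      using solves[of \<tau>] \<tau>(1) sub power by (auto simp: z_def)
    \<comment> \<open>By \<open>\<psi>_small\<close> the subtracted term stays below the squared
      distance, for either sign \<open>s\<close>.\<close>
    have "s * \<tau> ^ n \<le> norm (\<psi> z ^ n)" unfolding z(3) by (simp only: norm_of_real abs_ge_self)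
    also have "\<dots> < (norm (z - a))\<^sup>2 / n" by (rule \<psi>_small[OF z(1,2)])
    also have "\<dots> \<le> (norm (z - a))\<^sup>2" using n_ge by (simp add: divide_le_eq mult_le_cancel_left1)
    finally show ?thesis by (simp add: g_def z_def)
  qed
  ultimately have "\<exists>z \<in> ball a \<rho> - {a}. \<exists>t>0. \<psi> z = of_real t * u \<and>
      R z + of_real \<epsilon> / (z - a) = cnj z \<and> 0 < s * ((norm (z - a))\<^sup>2 - \<epsilon>)"
    if \<epsilon>: "0 < \<epsilon>" "\<epsilon> < g \<tau>" for \<epsilon>
  proof -
    obtain t where t: "0 \<le> t" "t \<le> \<tau>" "g t = \<epsilon>"
      using IVT'[of g 0 \<epsilon> \<tau>] \<open>continuous_on {0..\<tau>} g\<close> \<open>g 0 = 0\<close> \<epsilon> \<tau>(1) by auto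
    have "t > 0" using t \<epsilon> \<open>g 0 = 0\<close> by (cases "t = 0") auto
    define z where "z = \<phi> (of_real t * u)"
    have z: "z \<in> ball a \<rho> - {a}" "\<psi> z = of_real t * u"
      using solves[of t] t \<open>t > 0\<close> by (auto simp: z_def)
    have st: "(norm (z - a))\<^sup>2 - \<epsilon> = s * t ^ n"
      using t(3) by (simp add: g_def z_def)
    have "\<psi> z ^ n = of_real ((norm (z - a))\<^sup>2 - \<epsilon>)" unfolding st z(2) by (rule power)
    then have "R z + of_real \<epsilon> / (z - a) = cnj z"
      using perturbed_eq_cnj_iff[of z \<epsilon>] z(1) sub by auto
    moreover have "s * s = 1" using assms(4) by (metis abs_mult_self_eq mult_1)
    then have "0 < s * ((norm (z - a))\<^sup>2 - \<epsilon>)"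
      using \<open>t > 0\<close> unfolding st by (simp flip: mult.assoc)
    ultimately show ?thesis using z \<open>t > 0\<close> by blast
  qed
  then show ?thesis
    using \<open>g \<tau> > 0\<close> unfolding eventually_at_right_field by blast
qed

text \<open>The \<open>n\<close> roots of \<open>u ^ n = s\<close> give \<open>n\<close> rays in the
  coordinate \<open>\<psi>\<close>. The value \<open>s = 1\<close> selects the zeros outside radius
  \<open>sqrt \<epsilon>\<close>, and \<open>s = - 1\<close> those inside.\<close>

lemma card_perturbed_zeros_ge:
  assumes "0 < \<rho>" "\<rho> < \<delta>" "\<bar>s\<bar> = 1"
  shows "\<forall>\<^sub>F \<epsilon> in at_right 0. n \<le> card {z \<in> ball a \<rho> - {a}.
    R z + of_real \<epsilon> / (z - a) = cnj z \<and> 0 < s * ((norm (z - a))\<^sup>2 - \<epsilon>)}"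
proof -
  define C where "C = {u :: complex. u ^ n = of_real s}"
  have "s \<noteq> 0" using assms(3) by auto
  then have card_C: "card C = n" "finite C"
    unfolding C_def using n_ge by (auto simp: card_nth_roots finite_nth_roots)
  have "\<forall>\<^sub>F \<epsilon> in at_right 0. \<forall>u\<in>C. \<exists>z \<in> ball a \<rho> - {a}. \<exists>t>0. \<psi> z = of_real t * u \<and>
      R z + of_real \<epsilon> / (z - a) = cnj z \<and> 0 < s * ((norm (z - a))\<^sup>2 - \<epsilon>)"
    using card_C(2) assms by (intro eventually_ball_finite ballI perturbed_zero_on_ray) (auto simp: C_def)
  moreover have "\<forall>\<^sub>F \<epsilon> in at_right 0. (0::real) < \<epsilon>"
    by (rule eventually_at_right_less)
  ultimately show ?thesis
  proof eventually_elim
    case (elim \<epsilon>)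
    define Z where "Z = {z \<in> ball a \<rho> - {a}.
      R z + of_real \<epsilon> / (z - a) = cnj z \<and> 0 < s * ((norm (z - a))\<^sup>2 - \<epsilon>)}"
    have "\<forall>u\<in>C. \<exists>z. z \<in> Z \<and> (\<exists>t>0. \<psi> z = of_real t * u)"
      using elim(1) unfolding Z_def by blast
    then obtain \<zeta> where \<zeta>: "\<And>u. u \<in> C \<Longrightarrow> \<zeta> u \<in> Z \<and> (\<exists>t>0. \<psi> (\<zeta> u) = of_real t * u)"
      by (elim bchoice[THEN exE]) blast
    have norm_C: "norm u = 1" if "u \<in> C" for u
      using that assms(3) n_ge by (intro norm_unit_root) (auto simp: C_def)
    \<comment> \<open>The direction of \<open>\<psi>\<close> recovers the ray, so zeros on different
      rays are different.\<close>
    have sgn_\<zeta>: "sgn (\<psi> (\<zeta> u)) = u" if "u \<in> C" for u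
    proof -
      obtain t where "t > 0" "\<psi> (\<zeta> u) = of_real t * u" using \<zeta>[OF \<open>u \<in> C\<close>] by blast
      then show ?thesis using norm_C[OF that] by (simp add: sgn_eq norm_mult)
    qed
    have "inj_on \<zeta> C" using sgn_\<zeta> by (rule inj_on_inverseI)
    moreover have "\<zeta> ` C \<subseteq> Z" using \<zeta> by blast
    moreover have "finite Z"
      by (rule finite_subset[OF _ finite_perturbed_zeros[OF elim(2) assms(2)]]) (auto simp: Z_def)
    ultimately have "card C \<le> card Z" by (rule card_inj_on_le)
    then show ?case by (simp add: card_C Z_def)
  qed
qed

end

section \<open>Poles and persistent zeros after the perturbation\<close>

text \<open>At each point at most one of the two summands has a pole, as
  \<open>poly q a \<noteq> 0\<close>, so poles cannot cancel.\<close>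

lemma is_pole_perturbed_rational_iff:
  fixes p q :: "complex poly"
  assumes "coprime p q" "q \<noteq> 0" "poly q a \<noteq> 0" "c \<noteq> 0"
  shows "is_pole (\<lambda>z. poly p z / poly q z + c / (z - a)) b \<longleftrightarrow> poly q b = 0 \<or> b = a"
proof -
  have lim: "((\<lambda>z. poly p z / poly q z) \<longlongrightarrow> poly p b / poly q b) (at b)" if "poly q b \<noteq> 0"
    using that by (intro tendsto_intros)
  have lim': "((\<lambda>z. c / (z - a)) \<longlongrightarrow> c / (b - a)) (at b)" if "b \<noteq> a"
    using that by (intro tendsto_intros) simp
  consider "b = a" | "b \<noteq> a" "poly q b = 0" | "b \<noteq> a" "poly q b \<noteq> 0" by blast
  then show ?thesis
  proof cases
    case 1
    have "is_pole (\<lambda>z. c * (1 / (z - a))) a"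
      using is_pole_inverse[of a] assms(4) by (simp only: is_pole_cmult_iff not_False_eq_True)
    then have "filterlim (\<lambda>z. c / (z - a)) at_infinity (at b)"
      by (simp add: is_pole_def 1)
    with lim assms(3) 1 have "is_pole (\<lambda>z. poly p z / poly q z + c / (z - a)) b"
      unfolding is_pole_def by (intro tendsto_add_filterlim_at_infinity) auto
    with 1 show ?thesis by simp
  next
    case 2
    have "is_pole (\<lambda>z. poly p z / poly q z) b"
      using is_pole_rational_iff[OF assms(1,2)] 2 by simp
    with lim'[OF 2(1)] have "is_pole (\<lambda>z. poly p z / poly q z + c / (z - a)) b"
      unfolding is_pole_def by (intro tendsto_add_filterlim_at_infinity')
    with 2 show ?thesis by simp
  next
    case 3
    have "\<not> is_pole (\<lambda>z. poly p z / poly q z + c / (z - a)) b"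
      using not_tendsto_and_filterlim_at_infinity[OF at_neq_bot tendsto_add[OF lim[OF 3(2)] lim'[OF 3(1)]]]
      unfolding is_pole_def by (rule notI)
    with 3 show ?thesis by simp
  qed
qed

text \<open>On the ball the term \<open>\<epsilon> / (x - a)\<close> has Lipschitz constant at most
  \<open>\<epsilon> / r ^ 2\<close>. The slack between \<open>1 / 4\<close> here and
  \<open>1 / 2\<close> in \<open>perturbed_regular_zero_ex1\<close> absorbs it, and the same
  \<open>c\<close> determines both indices.\<close>

lemma regular_zero_persists:
  fixes A :: "complex \<Rightarrow> complex"
  assumes "norm c \<noteq> 1" "r > 0" and zero: "A z = cnj z" and cont: "continuous_on (cball z r) A"
    and near: "\<And>x y. x \<in> cball z r \<Longrightarrow> y \<in> cball z r \<Longrightarrow>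
      norm (A x - A y - c * (x - y)) \<le> \<bar>norm c - 1\<bar> / 4 * norm (x - y)"
    and far: "\<And>x. x \<in> cball z r \<Longrightarrow> r \<le> norm (x - a)"
  shows "\<forall>\<^sub>F \<epsilon> in at_right 0. \<exists>w. {x \<in> ball z r. A x + of_real \<epsilon> / (x - a) = cnj x} = {w} \<and>
    poincare_index w (\<lambda>x. A x + of_real \<epsilon> / (x - a) - cnj x) = poincare_index z (\<lambda>x. A x - cnj x)"
proof -
  define m where "m = \<bar>norm c - 1\<bar>"
  have "m > 0" using assms(1) by (simp add: m_def)
  define k where "k = (if norm c > 1 then 1 else - 1 :: int)"
  have index: "poincare_index w (\<lambda>x. B x - cnj x) = k"
    if w: "w \<in> ball z r" and "B w = cnj w" and contB: "continuous_on (cball z r) B"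
      and B: "\<And>x y. x \<in> cball z r \<Longrightarrow> y \<in> cball z r \<Longrightarrow> norm (B x - B y - c * (x - y)) \<le> m / 2 * norm (x - y)"
    for B w
  proof -
    obtain s where s: "s > 0" "ball w s \<subseteq> ball z r" using open_ball w by (rule openE)
    have "has_poincare_index w (\<lambda>x. B x - cnj x) k"
      unfolding k_def
    proof (rule has_poincare_index_harmonic[OF s(1)])
      show "continuous_on (ball w s - {w}) B"
        using contB
      proof (rule continuous_on_subset)
        show "ball w s - {w} \<subseteq> cball z r" using s(2) ball_subset_cball[of z r] by blast
      qed
      fix x assume x: "x \<in> ball w s - {w}"
      then have "norm (B x - B w - c * (x - w)) \<le> m / 2 * norm (x - w)"
        using subsetD[OF s(2), of x] w by (intro B) auto
      also have "\<dots> < m * norm (x - w)" using x \<open>m > 0\<close> by simp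
      finally show "norm (B x - B w - c * (x - w)) < \<bar>norm c - 1\<bar> * norm (x - w)"
        by (simp only: m_def)
    qed fact
    then show ?thesis by (rule poincare_index_unique)
  qed
  have index_z: "poincare_index z (\<lambda>x. A x - cnj x) = k"
  proof (rule index)
    fix x y assume "x \<in> cball z r" "y \<in> cball z r"
    then have "norm (A x - A y - c * (x - y)) \<le> m / 4 * norm (x - y)" unfolding m_def by (rule near)
    also have "\<dots> \<le> m / 2 * norm (x - y)" using \<open>m > 0\<close> by (intro mult_right_mono) auto
    finally show "norm (A x - A y - c * (x - y)) \<le> m / 2 * norm (x - y)" .
  qed (use \<open>r > 0\<close> zero cont in auto)
  \<comment> \<open>The threshold \<open>m / 4 * r ^ 2\<close> keeps the added Lipschitz constant
    below \<open>m / 4\<close> and the defect at the centre, at most \<open>\<epsilon> / r\<close>,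
    below \<open>m / 4 * r\<close>.\<close>
  have persist: "\<exists>w. {x \<in> ball z r. A x + of_real \<epsilon> / (x - a) = cnj x} = {w} \<and>
      poincare_index w (\<lambda>x. A x + of_real \<epsilon> / (x - a) - cnj x) = k"
    if \<epsilon>: "0 < \<epsilon>" "\<epsilon> < m / 4 * r\<^sup>2" for \<epsilon>
  proof -
    define B where "B x = A x + of_real \<epsilon> / (x - a)" for x
    have off: "x - a \<noteq> 0" if "x \<in> cball z r" for x using far[OF that] \<open>r > 0\<close> by auto
    have "\<epsilon> / r\<^sup>2 < m / 4" using \<epsilon> \<open>r > 0\<close> by (subst pos_divide_less_eq) auto
    have B: "norm (B x - B y - c * (x - y)) \<le> m / 2 * norm (x - y)"
      if xy: "x \<in> cball z r" "y \<in> cball z r" for x y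
    proof -
      have "of_real \<epsilon> / (x - a) - of_real \<epsilon> / (y - a) = of_real \<epsilon> * (y - x) / ((x - a) * (y - a))"
        unfolding diff_frac_eq[OF off[OF xy(1)] off[OF xy(2)]] by (simp add: right_diff_distrib)
      then have "norm (of_real \<epsilon> / (x - a) - of_real \<epsilon> / (y - a))
          = \<epsilon> * norm (x - y) / (norm (x - a) * norm (y - a))"
        using \<epsilon>(1) by (simp add: norm_mult norm_divide norm_minus_commute[of y x])
      also have "\<dots> \<le> \<epsilon> * norm (x - y) / (r * r)"
        using far[OF xy(1)] far[OF xy(2)] \<epsilon>(1) \<open>r > 0\<close>
        by (intro divide_left_mono mult_mono mult_pos_pos) auto
      also have "\<dots> = \<epsilon> / r\<^sup>2 * norm (x - y)" by (simp add: power2_eq_square)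
      also have "\<dots> \<le> m / 4 * norm (x - y)"
        using \<open>\<epsilon> / r\<^sup>2 < m / 4\<close> by (intro mult_right_mono) auto
      finally have pert: "norm (of_real \<epsilon> / (x - a) - of_real \<epsilon> / (y - a)) \<le> m / 4 * norm (x - y)" .
      have "B x - B y - c * (x - y)
          = (A x - A y - c * (x - y)) + (of_real \<epsilon> / (x - a) - of_real \<epsilon> / (y - a))"
        by (simp add: B_def)
      also have "norm \<dots> \<le> m / 4 * norm (x - y) + m / 4 * norm (x - y)"
        using near[OF xy] pert unfolding m_def by (rule norm_triangle_mono)
      finally show ?thesis by simp
    qed
    have contB: "continuous_on (cball z r) B"
      unfolding B_def using cont off by (intro continuous_intros) auto
    have "z \<in> cball z r" using \<open>r > 0\<close> by simp
    have "norm (B z - cnj z) = \<epsilon> / norm (z - a)"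
      using zero \<epsilon>(1) by (simp add: B_def norm_divide)
    also have "\<dots> \<le> \<epsilon> / r"
      using far[OF \<open>z \<in> cball z r\<close>] \<open>r > 0\<close> \<epsilon>(1) by (intro divide_left_mono mult_pos_pos) auto
    also have "\<dots> < m / 4 * r"
      using \<epsilon>(2) unfolding pos_divide_less_eq[OF \<open>r > 0\<close>] power2_eq_square mult.assoc .
    also have "\<dots> \<le> m * r / 2" using \<open>m > 0\<close> \<open>r > 0\<close> by simp
    finally have "norm (B z - cnj z) < \<bar>norm c - 1\<bar> * r / 2" by (simp only: m_def)
    with B have ex1: "\<exists>!w. w \<in> ball z r \<and> B w - cnj w = 0"
      unfolding m_def by (rule perturbed_regular_zero_ex1[OF assms(1,2)])
    from ex1 obtain w where w: "w \<in> ball z r" "B w = cnj w" by auto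
    have unique: "x = w" if "x \<in> ball z r" "B x = cnj x" for x
      using ex1 that w by (metis right_minus_eq)
    have "{x \<in> ball z r. B x = cnj x} = {w}" using w unique by blast
    moreover have "poincare_index w (\<lambda>x. B x - cnj x) = k" using w contB B by (rule index)
    ultimately show ?thesis unfolding B_def by blast
  qed
  show ?thesis
    unfolding index_z eventually_at_right_field
    using persist \<open>m > 0\<close> \<open>r > 0\<close> by (intro exI[of _ "m / 4 * r\<^sup>2"]) simp
qed

text \<open>Because all small radii qualify, finitely many zeros can share one radius. The factor
  \<open>2\<close> leaves room for disjoint disks.\<close>

lemma regular_zero_radius:
  fixes A :: "complex \<Rightarrow> complex"
  assumes "A holomorphic_on U" "open U" "z \<in> U" "e > 0" "finite Z"
  shows "\<forall>\<^sub>F r in at_right 0. cball z r \<subseteq> U \<and>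
    (\<forall>x\<in>cball z r. \<forall>y\<in>cball z r. norm (A x - A y - deriv A z * (x - y)) \<le> e * norm (x - y)) \<and>
    (\<forall>y\<in>Z - {z}. 2 * r < dist z y)"
proof -
  obtain s where s: "s > 0" "cball z s \<subseteq> U"
      "\<And>x y. x \<in> cball z s \<Longrightarrow> y \<in> cball z s \<Longrightarrow> norm (A x - A y - deriv A z * (x - y)) \<le> e * norm (x - y)"
    by (rule strict_derivative_bound[OF assms(1-4)]) (rule that; blast)
  have less: "\<forall>\<^sub>F r in at_right 0. r < t" if "t > 0" for t :: real
    using that unfolding eventually_at_right_field by blast
  have "\<forall>\<^sub>F r in at_right 0. \<forall>y\<in>Z - {z}. r < dist z y / 2"
    using assms(5) by (intro eventually_ball_finite ballI less) auto
  with less[OF s(1)] show ?thesis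
  proof eventually_elim
    case (elim r)
    then have "cball z r \<subseteq> cball z s" by (intro subset_cball) simp
    then have "cball z r \<subseteq> U"
      "\<forall>x\<in>cball z r. \<forall>y\<in>cball z r. norm (A x - A y - deriv A z * (x - y)) \<le> e * norm (x - y)"
      using s(2,3) by blast+
    moreover have "\<forall>y\<in>Z - {z}. 2 * r < dist z y"
    proof
      fix y assume "y \<in> Z - {z}"
      with elim(2) have "r < dist z y / 2" by (rule bspec)
      then show "2 * r < dist z y" by simp
    qed
    ultimately show ?case by blast
  qed
qed

section \<open>The perturbed function\<close>

theorem theorem3p1:
  fixes p q :: "complex poly" and R :: "complex \<Rightarrow> complex" and S :: "real \<Rightarrow> complex \<Rightarrow> complex"
    and f :: "complex \<Rightarrow> complex" and F :: "real \<Rightarrow> complex \<Rightarrow> complex"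
    and z0 :: complex and n :: nat and \<eta> :: real
  assumes "coprime p q" and "q \<noteq> 0" and "max (degree p) (degree q) \<ge> 2"
    and R_def: "R = (\<lambda>z. poly p z / poly q z)"
    and f_def: "f = (\<lambda>z. R z - cnj z)"
    and "filterlim f at_infinity at_infinity"
    and "n \<ge> 3"
    and "z0 \<in> zeros R"
    and "\<forall>k\<in>{1..n - 2}. (deriv ^^ k) R z0 = 0"
    and "(deriv ^^ (n - 1)) R z0 \<noteq> 0"
    and \<eta>_def: "\<eta> = sqrt (real n / (real n - 1))"
    and S_def: "\<And>\<epsilon>. S \<epsilon> = (\<lambda>z. R z + of_real \<epsilon> / (z - z0))"
    and F_def: "\<And>\<epsilon>. F \<epsilon> = (\<lambda>z. f z + of_real \<epsilon> / (z - z0))"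
  shows "\<forall>\<^sub>F \<epsilon> in at_right 0.
    zeros R \<inter> cball z0 (\<eta> * sqrt \<epsilon>) = {z0} \<and>

    n \<le> card (zeros (S \<epsilon>) \<inter> annulus z0 (sqrt \<epsilon> / \<eta>) (sqrt \<epsilon>)) \<and>
    n \<le> card (zeros (S \<epsilon>) \<inter> annulus z0 (sqrt \<epsilon>) (\<eta> * sqrt \<epsilon>)) \<and>
    zeros (S \<epsilon>) \<inter> cball z0 (sqrt \<epsilon> / \<eta>) = {} \<and>
    (regular (S \<epsilon>) \<longrightarrow>
      n \<le> card {z \<in> zeros (S \<epsilon>) \<inter> annulus z0 (sqrt \<epsilon> / \<eta>) (sqrt \<epsilon>). sense_preserving (S \<epsilon>) z} \<and>
      n \<le> card {z \<in> zeros (S \<epsilon>) \<inter> annulus z0 (sqrt \<epsilon>) (\<eta> * sqrt \<epsilon>). sense_reversing (S \<epsilon>) z}) \<and>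

    finite (regular_zeros R - cball z0 (\<eta> * sqrt \<epsilon>)) \<and>
    (\<exists>r>0. disjoint_family_on (\<lambda>z. cball z r) (regular_zeros R - cball z0 (\<eta> * sqrt \<epsilon>)) \<and>
      (\<forall>z \<in> regular_zeros R - cball z0 (\<eta> * sqrt \<epsilon>).
        \<exists>w. zeros (S \<epsilon>) \<inter> ball z r = {w} \<and> poincare_index w (F \<epsilon>) = poincare_index z f)) \<and>

    (regular R \<longrightarrow>
      finite (zeros R - cball z0 (\<eta> * sqrt \<epsilon>)) \<and>
      finite (zeros (S \<epsilon>) - cball z0 (\<eta> * sqrt \<epsilon>)) \<and>
      card (zeros R - cball z0 (\<eta> * sqrt \<epsilon>)) = card (zeros (S \<epsilon>) - cball z0 (\<eta> * sqrt \<epsilon>)))"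
proof -

  \<comment> \<open>The zero sets as equations off the poles\<close>
  define S0 where "S0 \<epsilon> z \<longleftrightarrow> R z + of_real \<epsilon> / (z - z0) = cnj z" for \<epsilon> z
  have q0: "poly q z0 \<noteq> 0" and R0: "R z0 = cnj z0"
    using \<open>z0 \<in> zeros R\<close> is_pole_rational_iff[OF assms(1,2), of z0]
    by (auto simp: zeros_def minus_conj_def R_def)
  have zeros_R: "zeros R = {z. poly q z \<noteq> 0 \<and> R z = cnj z}"
    using is_pole_rational_iff[OF assms(1,2)] by (simp add: zeros_def minus_conj_def R_def)
  have zeros_S: "zeros (S \<epsilon>) = {z. poly q z \<noteq> 0 \<and> z \<noteq> z0 \<and> S0 \<epsilon> z}" if "\<epsilon> > 0" for \<epsilon>
    using is_pole_perturbed_rational_iff[OF assms(1,2) q0, of "of_real \<epsilon>"] that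
    by (simp add: zeros_def minus_conj_def S_def R_def S0_def)
  define U where "U = {z. poly q z \<noteq> 0}"
  have "open U" unfolding U_def by (intro open_Collect_neq continuous_intros)
  have holo_U: "R holomorphic_on U"
    unfolding R_def U_def by (intro holomorphic_intros) auto
  \<comment> \<open>\<open>n \<ge> 3\<close> puts \<open>1\<close> into the range of the vanishing
    derivatives.\<close>
  have "deriv R z0 = 0" using assms(7,9) by (auto dest: bspec[of _ _ 1])
  with q0 R0 have fin: "finite (zeros R)"
    unfolding zeros_R unfolding R_def by (rule finite_rational_eq_cnj)
  obtain \<psi> \<delta> where crit: "critical_zero R \<psi> z0 n \<delta>" and \<delta>_U: "ball z0 \<delta> \<subseteq> U"
  proof (rule critical_zero_exists[OF holo_U \<open>open U\<close> _ R0 assms(7,9,10)])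
    show "z0 \<in> U" using q0 by (simp add: U_def)
  qed (rule that)
  interpret critical_zero R \<psi> z0 n \<delta> by (rule crit)
  have \<eta>_pos: "\<eta> > 0" using assms(7) by (simp add: \<eta>_def)

  \<comment> \<open>One radius for all regular zeros\<close>
  \<comment> \<open>\<open>z0\<close> is itself regular, having derivative \<open>0\<close>, and is
    removed. The resulting set does not depend on \<open>\<epsilon>\<close>.\<close>
  define Z where "Z = regular_zeros R - {z0}"
  have Z_zeros: "Z \<subseteq> zeros R" by (auto simp: Z_def regular_zeros_def)
  have Z: "finite Z" "\<And>z. z \<in> Z \<Longrightarrow> z \<in> U \<and> R z = cnj z \<and> norm (deriv R z) \<noteq> 1 \<and> z \<noteq> z0"
    using finite_subset[OF Z_zeros fin]
    unfolding Z_def regular_zeros_def singular_point_def zeros_R U_def by auto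
  define m where "m z = \<bar>norm (deriv R z) - 1\<bar> / 4" for z
  have "\<forall>\<^sub>F r in at_right 0. \<forall>z\<in>Z. cball z r \<subseteq> U \<and>
      (\<forall>x\<in>cball z r. \<forall>y\<in>cball z r. norm (R x - R y - deriv R z * (x - y)) \<le> m z * norm (x - y)) \<and>
      (\<forall>y\<in>zeros R - {z}. 2 * r < dist z y)"
  proof (rule eventually_ball_finite[OF Z(1)], rule ballI)
    fix z assume "z \<in> Z"
    from Z(2)[OF this] have "z \<in> U" "m z > 0" by (auto simp: m_def)
    from regular_zero_radius[OF holo_U \<open>open U\<close> this fin]
    show "\<forall>\<^sub>F r in at_right 0. cball z r \<subseteq> U \<and>
      (\<forall>x\<in>cball z r. \<forall>y\<in>cball z r. norm (R x - R y - deriv R z * (x - y)) \<le> m z * norm (x - y)) \<and>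
      (\<forall>y\<in>zeros R - {z}. 2 * r < dist z y)" .
  qed
  from eventually_happens'[OF trivial_limit_at_right_real eventually_conj[OF this eventually_at_right_less]]
  obtain r where r: "r > 0"
    and r_Z: "\<forall>z\<in>Z. cball z r \<subseteq> U \<and>
      (\<forall>x\<in>cball z r. \<forall>y\<in>cball z r. norm (R x - R y - deriv R z * (x - y)) \<le> m z * norm (x - y)) \<and>
      (\<forall>y\<in>zeros R - {z}. 2 * r < dist z y)"
    by (elim exE conjE) (rule that)
  have r_U: "cball z r \<subseteq> U" if "z \<in> Z" for z
    using bspec[OF r_Z that] by (rule conjunct1)
  have r_near: "norm (R x - R y - deriv R z * (x - y)) \<le> m z * norm (x - y)"
    if "z \<in> Z" "x \<in> cball z r" "y \<in> cball z r" for x y z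
    using bspec[OF bspec[OF bspec[OF r_Z that(1), THEN conjunct2, THEN conjunct1] that(2)] that(3)] .
  have r_sep: "2 * r < dist z y" if "z \<in> Z" "y \<in> zeros R" "y \<noteq> z" for y z
    using bspec[OF bspec[OF r_Z that(1), THEN conjunct2, THEN conjunct2], of y] that(2,3) by simp
  have z0_zero: "z0 \<in> zeros R" by fact
  \<comment> \<open>Separation was required from every zero of \<open>R\<close>, in particular from
    \<open>z0\<close>, where the added pole sits.\<close>
  have sep0: "2 * r < dist z z0" if "z \<in> Z" for z
    using r_sep[OF that z0_zero] Z(2)[OF that] by blast
  have disj: "disjoint_family_on (\<lambda>z. cball z r) Z"
    unfolding disjoint_family_on_def
  proof (intro ballI impI)
    fix y z assume yz: "y \<in> Z" "z \<in> Z" "y \<noteq> z"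
    then have "2 * r < dist y z" using r_sep[of y z] Z_zeros by blast
    then show "cball y r \<inter> cball z r = {}"
      by (intro disjoint_cballI) simp
  qed
  have far: "r \<le> norm (x - z0)" if "z \<in> Z" "x \<in> cball z r" for x z
    using sep0[OF that(1)] that(2) dist_triangle[of z z0 x] by (simp add: dist_norm)

  \<comment> \<open>Properties holding for all small positive \<open>\<epsilon>\<close>\<close>
  have ev_persist: "\<forall>\<^sub>F \<epsilon> in at_right 0. \<forall>z\<in>Z. \<exists>w. {x \<in> ball z r. S0 \<epsilon> x} = {w} \<and>
      poincare_index w (F \<epsilon>) = poincare_index z f"
  proof (rule eventually_ball_finite[OF Z(1)], rule ballI)
    fix z assume z: "z \<in> Z"
    have F: "F \<epsilon> = (\<lambda>x. R x + of_real \<epsilon> / (x - z0) - cnj x)" for \<epsilon>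
      by (simp add: F_def f_def algebra_simps)
    from holomorphic_on_imp_continuous_on[OF holo_U] r_U[OF z] have "continuous_on (cball z r) R"
      by (rule continuous_on_subset)
    moreover have "norm (R x - R y - deriv R z * (x - y)) \<le> \<bar>norm (deriv R z) - 1\<bar> / 4 * norm (x - y)"
      if "x \<in> cball z r" "y \<in> cball z r" for x y
      using r_near[OF z that] unfolding m_def .
    ultimately show "\<forall>\<^sub>F \<epsilon> in at_right 0. \<exists>w. {x \<in> ball z r. S0 \<epsilon> x} = {w} \<and>
        poincare_index w (F \<epsilon>) = poincare_index z f"
      unfolding F f_def S0_def using Z(2)[OF z] far[OF z]
      by (intro regular_zero_persists[where c = "deriv R z"] r) simp_all
  qed

  \<comment> \<open>For regular \<open>R\<close> this is a neighbourhood of all its zeros, and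
    compactness then confines the perturbed zeros to it.\<close>
  define V where "V = ball z0 (\<delta> / 2) \<union> (\<Union>z\<in>Z. ball z r)"
  have ev_V: "\<forall>\<^sub>F \<epsilon> in at_right 0. \<forall>z. poly q z \<noteq> 0 \<and> S0 \<epsilon> z \<longrightarrow> z \<in> V" if "regular R"
    unfolding S0_def R_def
  proof (rule perturbed_zeros_near_zeros)
    show "open V" "z0 \<in> V" using \<delta>_pos by (auto simp: V_def)
    have "zeros R \<subseteq> V"
      using that \<delta>_pos r unfolding V_def Z_def regular_def by auto
    then show "{z. poly q z \<noteq> 0 \<and> poly p z / poly q z = cnj z} \<subseteq> V"
      unfolding zeros_R unfolding R_def .
    show "filterlim (\<lambda>z. poly p z / poly q z - cnj z) at_infinity at_infinity"
      using assms(6) by (simp add: f_def R_def)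
  qed fact

  have ev_small: "\<forall>\<^sub>F \<epsilon> in at_right 0. \<eta> * sqrt \<epsilon> < c" if "c > 0" for c
  proof -
    have "((\<lambda>\<epsilon>. \<eta> * sqrt \<epsilon>) \<longlongrightarrow> \<eta> * sqrt 0) (at_right 0)"
      by (intro tendsto_intros)
    then show ?thesis using that by (intro order_tendstoD) auto
  qed
  define W where "W \<epsilon> = {z \<in> ball z0 (\<delta> / 2) - {z0}. S0 \<epsilon> z}" for \<epsilon>
  have ev_card: "\<forall>\<^sub>F \<epsilon> in at_right 0. n \<le> card {z \<in> W \<epsilon>. 0 < s * ((norm (z - z0))\<^sup>2 - \<epsilon>)}"
    if "\<bar>s\<bar> = 1" for s
  proof -
    have "{z \<in> W \<epsilon>. 0 < s * ((norm (z - z0))\<^sup>2 - \<epsilon>)} = {z \<in> ball z0 (\<delta> / 2) - {z0}.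
        R z + of_real \<epsilon> / (z - z0) = cnj z \<and> 0 < s * ((norm (z - z0))\<^sup>2 - \<epsilon>)}" for \<epsilon>
      by (simp only: W_def S0_def mem_Collect_eq conj_assoc)
    then show ?thesis
      using card_perturbed_zeros_ge[of "\<delta> / 2" s] \<delta>_pos that by simp
  qed
  \<comment> \<open>The disk around \<open>z0\<close> has to stay inside the domain of the local
    analysis and, with radius below \<open>r\<close>, miss the disks around
    \<open>Z\<close>.\<close>
  have "\<forall>\<^sub>F \<epsilon> in at_right 0. \<eta> * sqrt \<epsilon> < \<delta> / 2" "\<forall>\<^sub>F \<epsilon> in at_right 0. \<eta> * sqrt \<epsilon> < r"
    by (rule ev_small, use \<delta>_pos r in simp)+
  moreover have "\<forall>\<^sub>F \<epsilon> in at_right 0. n \<le> card {z \<in> W \<epsilon>. 0 < 1 * ((norm (z - z0))\<^sup>2 - \<epsilon>)}"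
    "\<forall>\<^sub>F \<epsilon> in at_right 0. n \<le> card {z \<in> W \<epsilon>. 0 < - 1 * ((norm (z - z0))\<^sup>2 - \<epsilon>)}"
    by (rule ev_card, simp)+
  moreover have "\<forall>\<^sub>F \<epsilon> in at_right 0. regular R \<longrightarrow> (\<forall>z. poly q z \<noteq> 0 \<and> S0 \<epsilon> z \<longrightarrow> z \<in> V)"
    using ev_V by (cases "regular R") simp_all
  moreover have "\<forall>\<^sub>F \<epsilon> in at_right 0. (0::real) < \<epsilon>" by (rule eventually_at_right_less)
  ultimately show ?thesis using ev_persist
  proof eventually_elim

    \<comment> \<open>The claims for one small \<open>\<epsilon>\<close>\<close>
    case (elim \<epsilon>)
    note \<epsilon> = \<open>0 < \<epsilon>\<close>
    note zS = zeros_S[OF \<epsilon>]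
    have \<eta>1: "sqrt \<epsilon> / \<eta> < sqrt \<epsilon>" "sqrt \<epsilon> < \<eta> * sqrt \<epsilon>"
    proof -
      have "1 < \<eta>" using assms(7) by (simp add: \<eta>_def)
      then show "sqrt \<epsilon> / \<eta> < sqrt \<epsilon>" "sqrt \<epsilon> < \<eta> * sqrt \<epsilon>"
        using \<epsilon> by (simp_all add: pos_divide_less_eq)
    qed
    have near: "zeros (S \<epsilon>) \<inter> ball z0 (\<delta> / 2) = W \<epsilon>"
    proof -
      have "ball z0 (\<delta> / 2) \<subseteq> ball z0 \<delta>" using \<delta>_pos by (intro subset_ball) simp
      with \<delta>_U have "ball z0 (\<delta> / 2) \<subseteq> U" by (rule order_trans[rotated])
      then show ?thesis unfolding zS W_def U_def by blast
    qed
    have W: "z \<in> ball z0 \<delta>" "z \<noteq> z0" "R z + of_real \<epsilon> / (z - z0) = cnj z" if "z \<in> W \<epsilon>" for z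
      using that \<delta>_pos by (auto simp: W_def S0_def)
    have W_annulus: "sqrt \<epsilon> / \<eta> < norm (z - z0)" "norm (z - z0) < \<eta> * sqrt \<epsilon>" if "z \<in> W \<epsilon>" for z
      using perturbed_zero_annulus[OF W[OF that] \<epsilon> \<eta>_def] .
    have in_W: "z \<in> W \<epsilon>" if "z \<in> zeros (S \<epsilon>)" "norm (z - z0) \<le> \<eta> * sqrt \<epsilon>" for z
    proof -
      have "z \<in> ball z0 (\<delta> / 2)"
        using that(2) elim(1) unfolding mem_ball dist_norm norm_minus_commute[of z0 z] by linarith
      with that(1) show ?thesis unfolding near[symmetric] by (rule IntI)
    qed
    have W_zero: "z \<in> zeros (S \<epsilon>)" if "z \<in> W \<epsilon>" for z
      using that unfolding near[symmetric] by (rule IntD1)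
    have sq: "norm (z - z0) < sqrt \<epsilon> \<longleftrightarrow> (norm (z - z0))\<^sup>2 < \<epsilon>"
        "sqrt \<epsilon> < norm (z - z0) \<longleftrightarrow> \<epsilon> < (norm (z - z0))\<^sup>2" for z
      using real_sqrt_less_iff[of "(norm (z - z0))\<^sup>2" \<epsilon>] real_sqrt_less_iff[of \<epsilon> "(norm (z - z0))\<^sup>2"]
      by simp_all
    \<comment> \<open>The inner radius of the annulus is no restriction, since all elements of
      \<open>W \<epsilon>\<close> lie beyond it.\<close>
    have inner: "zeros (S \<epsilon>) \<inter> annulus z0 (sqrt \<epsilon> / \<eta>) (sqrt \<epsilon>)
        = {z \<in> W \<epsilon>. 0 < - 1 * ((norm (z - z0))\<^sup>2 - \<epsilon>)}" (is "?L = ?R")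
    proof (rule set_eqI, rule iffI)
      fix z assume "z \<in> ?L"
      then have z: "z \<in> zeros (S \<epsilon>)" "norm (z - z0) < sqrt \<epsilon>" by (auto simp: annulus_def)
      then show "z \<in> ?R" using in_W[OF z(1)] \<eta>1(2) sq(1)[of z] by simp
    next
      fix z assume "z \<in> ?R"
      then have z: "z \<in> W \<epsilon>" "(norm (z - z0))\<^sup>2 < \<epsilon>" by auto
      then show "z \<in> ?L" using W_zero[OF z(1)] W_annulus(1)[OF z(1)] sq(1)[of z] by (simp add: annulus_def)
    qed
    have outer: "zeros (S \<epsilon>) \<inter> annulus z0 (sqrt \<epsilon>) (\<eta> * sqrt \<epsilon>)
        = {z \<in> W \<epsilon>. 0 < 1 * ((norm (z - z0))\<^sup>2 - \<epsilon>)}" (is "?L = ?R")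
    proof (rule set_eqI, rule iffI)
      fix z assume "z \<in> ?L"
      then have z: "z \<in> zeros (S \<epsilon>)" "sqrt \<epsilon> < norm (z - z0)" "norm (z - z0) < \<eta> * sqrt \<epsilon>"
        by (auto simp: annulus_def)
      then show "z \<in> ?R" using in_W[OF z(1)] sq(2)[of z] by simp
    next
      fix z assume "z \<in> ?R"
      then have z: "z \<in> W \<epsilon>" "\<epsilon> < (norm (z - z0))\<^sup>2" by auto
      then show "z \<in> ?L" using W_zero[OF z(1)] W_annulus(2)[OF z(1)] sq(2)[of z] by (simp add: annulus_def)
    qed
    have preserving: "sense_preserving (S \<epsilon>) z" if "z \<in> W \<epsilon>" "0 < - 1 * ((norm (z - z0))\<^sup>2 - \<epsilon>)" for z
      using perturbed_zero_orientation(1)[OF W[OF that(1)]] that(2)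
      unfolding sense_preserving_def S_def by simp
    have reversing: "sense_reversing (S \<epsilon>) z" if "z \<in> W \<epsilon>" "0 < 1 * ((norm (z - z0))\<^sup>2 - \<epsilon>)" for z
      using perturbed_zero_orientation(2)[OF W[OF that(1)]] that(2)
      unfolding sense_reversing_def S_def by simp
    \<comment> \<open>Every zero in this annulus is sense-preserving, so the filter leaves the set
      and its count unchanged.\<close>
    have inner_sense: "{z \<in> zeros (S \<epsilon>) \<inter> annulus z0 (sqrt \<epsilon> / \<eta>) (sqrt \<epsilon>). sense_preserving (S \<epsilon>) z}
        = {z \<in> W \<epsilon>. 0 < - 1 * ((norm (z - z0))\<^sup>2 - \<epsilon>)}"
      unfolding inner using preserving by blast
    have outer_sense: "{z \<in> zeros (S \<epsilon>) \<inter> annulus z0 (sqrt \<epsilon>) (\<eta> * sqrt \<epsilon>). sense_reversing (S \<epsilon>) z}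
        = {z \<in> W \<epsilon>. 0 < 1 * ((norm (z - z0))\<^sup>2 - \<epsilon>)}"
      unfolding outer using reversing by blast
    have no_inner: "zeros (S \<epsilon>) \<inter> cball z0 (sqrt \<epsilon> / \<eta>) = {}"
    proof (rule equals0I)
      fix z assume "z \<in> zeros (S \<epsilon>) \<inter> cball z0 (sqrt \<epsilon> / \<eta>)"
      then have z: "z \<in> zeros (S \<epsilon>)" "norm (z - z0) \<le> sqrt \<epsilon> / \<eta>"
        by (auto simp: dist_norm norm_minus_commute)
      then have "z \<in> W \<epsilon>" using \<eta>1 by (intro in_W) auto
      from W_annulus(1)[OF this] z(2) show False by simp
    qed
    have zR: "zeros R \<inter> cball z0 (\<eta> * sqrt \<epsilon>) = {z0}"
    proof (rule set_eqI, rule iffI)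
      fix z assume z: "z \<in> zeros R \<inter> cball z0 (\<eta> * sqrt \<epsilon>)"
      then have "z \<in> ball z0 \<delta>" "R z = cnj z"
        using elim(1) \<delta>_pos by (auto simp: zeros_R)
      then show "z \<in> {z0}" using eq_cnj_imp_eq_centre by blast
    next
      fix z assume "z \<in> {z0}"
      then show "z \<in> zeros R \<inter> cball z0 (\<eta> * sqrt \<epsilon>)"
        using z0_zero \<eta>_pos \<epsilon> by simp
    qed
    have Z_eq: "regular_zeros R - cball z0 (\<eta> * sqrt \<epsilon>) = Z"
    proof -
      have "regular_zeros R \<subseteq> zeros R" by (auto simp: regular_zeros_def)
      then show ?thesis unfolding Z_def using zR by blast
    qed
    have ball_U: "ball z r \<subseteq> U" "z0 \<notin> ball z r" if "z \<in> Z" for z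
      using r_U[OF that] sep0[OF that] r ball_subset_cball[of z r] by (blast, simp)
    have zS_ball: "zeros (S \<epsilon>) \<inter> ball z r = {x \<in> ball z r. S0 \<epsilon> x}" if "z \<in> Z" for z
      unfolding zS using ball_U[OF that] unfolding U_def by blast
    have persist: "\<exists>w. zeros (S \<epsilon>) \<inter> ball z r = {w} \<and> poincare_index w (F \<epsilon>) = poincare_index z f"
      if "z \<in> Z" for z
      using elim(7) that unfolding zS_ball[OF that] by blast
    have count: "finite (zeros R - cball z0 (\<eta> * sqrt \<epsilon>)) \<and>
        finite (zeros (S \<epsilon>) - cball z0 (\<eta> * sqrt \<epsilon>)) \<and>
        card (zeros R - cball z0 (\<eta> * sqrt \<epsilon>)) = card (zeros (S \<epsilon>) - cball z0 (\<eta> * sqrt \<epsilon>))"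
      if reg: "regular R"
    proof -
      have ZR: "zeros R - cball z0 (\<eta> * sqrt \<epsilon>) = Z"
        using Z_eq reg unfolding regular_def by simp
      \<comment> \<open>\<open>w\<close> sends each zero of \<open>f\<close> to the one continuing
        it; disjoint disks make it injective, and the covering by \<open>V\<close> makes it
        onto.\<close>
      obtain w where w: "\<And>z. z \<in> Z \<Longrightarrow> zeros (S \<epsilon>) \<inter> ball z r = {w z}"
        using bchoice[of Z "\<lambda>z w. zeros (S \<epsilon>) \<inter> ball z r = {w}"] persist by blast
      have w_in: "w z \<in> zeros (S \<epsilon>)" "w z \<in> ball z r" if "z \<in> Z" for z
        using w[OF that] by blast+
      have "inj_on w Z"
      proof (rule inj_onI, rule ccontr)
        fix y z assume yz: "y \<in> Z" "z \<in> Z" "w y = w z" "y \<noteq> z"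
        then have "cball y r \<inter> cball z r = {}" using disj unfolding disjoint_family_on_def by blast
        then show False
          using w_in(2)[OF yz(1)] w_in(2)[OF yz(2)] yz(3) ball_subset_cball by (metis disjoint_iff subsetD)
      qed
      moreover have "w ` Z = zeros (S \<epsilon>) - cball z0 (\<eta> * sqrt \<epsilon>)"
      proof (rule set_eqI, rule iffI)
        fix x assume "x \<in> w ` Z"
        then obtain z where z: "z \<in> Z" "x = w z" by blast
        then have "x \<in> cball z r" using w_in(2)[OF z(1)] by simp
        then have "\<eta> * sqrt \<epsilon> < norm (x - z0)"
          using far[OF z(1)] elim(2) by fastforce
        then show "x \<in> zeros (S \<epsilon>) - cball z0 (\<eta> * sqrt \<epsilon>)"
          using w_in(1)[OF z(1)] z(2) by (simp add: dist_norm norm_minus_commute)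
      next
        fix x assume x: "x \<in> zeros (S \<epsilon>) - cball z0 (\<eta> * sqrt \<epsilon>)"
        then have "x \<in> V" using elim(5) reg unfolding zS by blast
        \<comment> \<open>Near \<open>z0\<close> all perturbed zeros lie within
          \<open>\<eta> * sqrt \<epsilon>\<close>, so \<open>x\<close> must belong to a disk around
          a point of \<open>Z\<close>.\<close>
        moreover have "x \<notin> ball z0 (\<delta> / 2)"
        proof
          assume "x \<in> ball z0 (\<delta> / 2)"
          then have "x \<in> W \<epsilon>" using x near by blast
          from W_annulus(2)[OF this] x show False by (simp add: dist_norm norm_minus_commute)
        qed
        ultimately obtain z where "z \<in> Z" "x \<in> ball z r" unfolding V_def by blast
        then show "x \<in> w ` Z" using w[of z] x by blast
      qed
      ultimately have "bij_betw w Z (zeros (S \<epsilon>) - cball z0 (\<eta> * sqrt \<epsilon>))"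
        by (simp add: bij_betw_def)
      then show ?thesis
        unfolding ZR using Z(1) bij_betw_finite bij_betw_same_card by blast
    qed
    show ?case
      unfolding inner_sense outer_sense
      unfolding inner outer Z_eq
    proof (intro conjI impI)
      show "\<exists>r>0. disjoint_family_on (\<lambda>z. cball z r) Z \<and>
          (\<forall>z\<in>Z. \<exists>w. zeros (S \<epsilon>) \<inter> ball z r = {w} \<and> poincare_index w (F \<epsilon>) = poincare_index z f)"
        using r disj persist by blast
    qed (use zR elim(3,4) no_inner Z(1) count in simp_all)
  qed
qed

end
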